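(* Let $A,B,C$ be distinct propositional variables. Consider the five predicates (1) $A\to((A\to B)\to B)$; (2) $(A\to{\sim}B)\to(B\to{\sim}A)$; (3) $(A\to(B\to C))\to(B\to(A\to C))$; (4) $(A\to B)\to((B\to C)\to(A\to C))$; (5) $(A\to(B\to C))\to((A\to B)\to(A\to C))$. They are in $\mathsf R$ and $\mathsf{TR}$ but not in $\mathsf{CT}_\omega$. They are not $\omega$-provable from density. They are invalid in a $\mathsf{CR}^*$-frame whose complex algebra is a non-commutative dense representable relation algebra.
   Context: **Predicates.** $\Pi$ is a countably infinite set of binary relation symbols containing the equality symbol $1'$; members of $\Pi$ other than $1'$ are propositional variables. $\Pi^+$ (predicates) is the absolutely free closure of $\Pi$ under the formal operators $A+B$, $\overline A$, $A;B$, $A^\smile$. Abbreviations: $A\lor B=A+B$, $A\land B=\overline{\overline A+\overline B}$, ${\sim}A=\overline{A^\smile}$, $A\to B=\overline{A^\smile;\overline B}$, $A\circ B=B;A$, $\mathbf t=1'$. $\Pi^r$ is the closure of $\Pi$ under $\lor,\land,{\sim},\to,\circ,\mathbf t$. An equation is a formal expression $A\doteq B$; $A\le B$ denotes $A+B\doteq B$. $\mathfrak P=(\Pi^+,+,\overline{\phantom a},;,{}^\smile,1')$. $\Xi^d=\{A\le A;A:A\in\Pi^+\}$ (density), $\Xi^c=\{A;B\doteq B;A:A,B\in\Pi^+\}$ (commutativity). **Algebras.** A proper relation algebra is an algebra $(U,+,\overline{\phantom a},;,{}^\smile,1')$ for which there is an equivalence relation $E\in U$ such that $U$ is a set of binary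 relations included in $E$, $+$ is union, $\overline X=E\setminus X$, $X;Y=\{(x,y):\exists z\,(x,z)\in X,(z,y)\in Y\}$, $X^\smile$ is the converse of $X$, and $1'=\{(x,x):(x,x)\in E\}$. A representable relation algebra is an algebra isomorphic to a proper relation algebra. An algebra is dense if $x+x;x=x;x$ for all $x$, commutative if $x;y=y;x$ for all $x,y$. **Frames and $\mathsf R$.** A frame is $\mathfrak K=(K,R,{}^*,\mathcal I)$ with $R\subseteq K^3$, ${}^*\colon K\to K$, $\mathcal I\subseteq K$. Its complex algebra $\mathfrak{Cm}(\mathfrak K)$ is $(\wp(K),\cup,\overline{\phantom a},;,{}^\smile,\mathcal I)$ with $\overline X=K\setminus X$, $X;Y=\{z:Rxyz\text{ for some }x\in X,y\in Y\}$, $X^\smile=\{z^*:z\in X\}$. $A\in\Pi^+$ is valid in $\mathfrak K$ if $\mathcal I\subseteq h(A)$ for every homomorphism $h\colon\mathfrak P\to\mathfrak{Cm}(\mathfrak K)$, and invalid otherwise. A $\mathsf{CR}^*$-frame is a frame with $\mathcal I=\{0\}$ and, for all $a,b,c,d$: $R0ab\Leftrightarrow a=b$; $\exists x(Rabx\land Rxcd)\Leftrightarrow\exists y(Racy\land Rybd)$; $Raaa$; $a^{**}=a$; $Rabc\Leftrightarrow Rac^*b^*$. $\mathsf{CR}^*$ is the set of predicates valid in every $\mathsf{CR}^*$-frame and $\mathsf R=\mathsf{CR}^*\cap\Pi^r$. **First-order provability.** For $3\le n\le\omega$ let $\Upsilon_n=\{v_i:i<n\}$ and let $\Phi_n^+$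 be the set of formulas built from $xAy$ ($x,y\in\Upsilon_n$, $A\in\Pi^+$) and equations (no free variables) by $\Rightarrow,\neg,\forall x$ with $x\in\Upsilon_n$ ($\lor,\land,\Leftrightarrow,\exists$ the usual abbreviations). $[\varphi]$ is the universal closure; $S_{xy}\varphi$ interchanges $x$ and $y$ everywhere in $\varphi$ (including in quantifiers). Axioms, for $\varphi,\psi,\xi\in\Phi_n^+$, $x,y\in\Upsilon_n$, $A,B\in\Pi^+$: $[(\varphi\Rightarrow\psi)\Rightarrow((\psi\Rightarrow\xi)\Rightarrow(\varphi\Rightarrow\xi))]$; $[(\neg\varphi\Rightarrow\varphi)\Rightarrow\varphi]$; $[\varphi\Rightarrow(\neg\varphi\Rightarrow\psi)]$; $[\forall x\forall y\varphi\Rightarrow\forall y\forall x\varphi]$; $[\forall x(\varphi\Rightarrow\psi)\Rightarrow(\forall x\varphi\Rightarrow\forall x\psi)]$; $[\forall x\varphi\Rightarrow\varphi]$; $[\varphi\Rightarrow\forall x\varphi]$ if $x$ is not free in $\varphi$; $[\exists x(x1'y)]$ if $x\ne y$; a Leibniz axiom, namely $[x1'y\Rightarrow(\varphi\Rightarrow S_{xy}\varphi)]$ if $n<\omega$, and $[x1'y\Rightarrow(\varphi\Rightarrow\psi)]$ if $n=\omega$, where in the latter case $\varphi$ is atomic, $x$ occurs in $\varphi$ and $\psi$ results from $\varphi$ by replacing one occurrence of $x$ by $y$; $[v_0(A+B)v_1\Leftrightarrow v_0Av_1\lor v_0Bv_1]$; $[v_0\overline Av_1\Leftrightarrow\neg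 v_0Av_1]$; $[v_0(A;B)v_1\Leftrightarrow\exists v_2(v_0Av_2\land v_2Bv_1)]$; $[v_0A^\smile v_1\Leftrightarrow v_1Av_0]$; $A\doteq B\Leftrightarrow[v_0Av_1\Leftrightarrow v_0Bv_1]$. Provability from $\Psi$ (membership in every set containing $\Psi$ and the axioms and closed under modus ponens) is written $\vdash_4^+$ for $n=4$ and $\vdash^+$ for $n=\omega$. $\mathsf{TR}=\{A\in\Pi^+:\Xi^d\cup\Xi^c\vdash_4^+1'\le A\}$ and $\mathsf{CT}_\omega=\{A\in\Pi^+:\ \vdash^+1'\le A\}$. **Sequent calculus.** An $\omega$-sequent $\Gamma\,|\,\Delta$ is a pair of subsets of $\{xAy:x,y\in\Upsilon_\omega,A\in\Pi^+\}$. It is an axiom if $\Gamma\cap\Delta\ne\emptyset$ or $x1'x\in\Delta$ for some $x$. Rules (premises $\leadsto$ conclusion): Cut: $\Gamma|\Delta,xAy$ and $xAy,\Gamma'|\Delta'\leadsto\Gamma,\Gamma'|\Delta,\Delta'$. Equality: $xAy,\Gamma|\Delta\leadsto xAz,z1'y,\Gamma|\Delta$. Sum: $xAy,\Gamma|\Delta$ and $xBy,\Gamma'|\Delta'\leadsto x(A+B)y,\Gamma,\Gamma'|\Delta,\Delta'$; $\Gamma|\Delta,xAy,xBy\leadsto\Gamma|\Delta,x(A+B)y$. Complement: $\Gamma|\Delta,xAy\leadsto x\overline Ay,\Gamma|\Delta$; $xAy,\Gamma|\Delta\leadsto\Gamma|\Delta,x\overline Ay$. Relative product: $xAy,yBz,\Gamma|\Delta\leadsto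 x(A;B)z,\Gamma|\Delta$ provided $y\ne x,z$ and $y$ occurs in no formula of $\Gamma\cup\Delta$; $\Gamma|\Delta,xAy$ and $\Gamma'|\Delta',yBz\leadsto\Gamma,\Gamma'|\Delta,\Delta',x(A;B)z$. Converse: $xAy,\Gamma|\Delta\leadsto yA^\smile x,\Gamma|\Delta$; $\Gamma|\Delta,xAy\leadsto\Gamma|\Delta,yA^\smile x$. A predicate $A$ is $\omega$-provable from density if $\;|\;v_0Av_0$ lies in every set of $\omega$-sequents that contains the axioms and all sequents $v_iXv_j,\Gamma|v_iYv_j,\Delta$ and $v_iYv_j,\Gamma|v_iXv_j,\Delta$ with $X\doteq Y$ in $\Xi^d$, and is closed under the rules.
   Formalization: In the last sentence "CR*-frame" is weakened to a frame with I={0}, R0ab⇔a=b, Raaa and a**=a; the postulates ∃x(Rabx∧Rxcd)⇔∃y(Racy∧Rybd) and Rabc⇔Rac*b* are dropped, as each rules out a non-commutative relation algebra. *)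

theory Defs
  imports "HOL-Library.Extended_Nat" "HOL-Combinatorics.Transposition"
begin

section \<open>Predicates\<close>

datatype predicate =
    Ident                            (\<open>1\<^sub>p\<close>)
  | PVar nat
  | Sum predicate predicate          (infixl \<open>\<^bold>+\<close> 65)
  | Compl predicate                  (\<open>\<^bold>-_\<close> [85] 85)
  | RelProd predicate predicate      (infixl \<open>\<^bold>;\<close> 75)
  | Conv predicate                   (\<open>_\<^sup>\<smile>\<close> [1000] 1000)

definition propositional_variables :: "predicate set" where
  "propositional_variables = range PVar"

abbreviation Or (infixl \<open>\<^bold>\<or>\<close> 65) where "A \<^bold>\<or> B \<equiv> A \<^bold>+ B"
abbreviation And (infixl \<open>\<^bold>\<and>\<close> 70) where "A \<^bold>\<and> B \<equiv> \<^bold>-(\<^bold>-A \<^bold>+ \<^bold>-B)"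
abbreviation Neg (\<open>\<^bold>\<sim>_\<close> [85] 85) where "\<^bold>\<sim>A \<equiv> \<^bold>-(A\<^sup>\<smile>)"
abbreviation Arrow (infixr \<open>\<^bold>\<rightarrow>\<close> 60) where "A \<^bold>\<rightarrow> B \<equiv> \<^bold>-(A\<^sup>\<smile> \<^bold>; \<^bold>-B)"
abbreviation Fusion (infixl \<open>\<^bold>\<circ>\<close> 75) where "A \<^bold>\<circ> B \<equiv> B \<^bold>; A"
abbreviation Truth (\<open>\<^bold>t\<close>) where "\<^bold>t \<equiv> 1\<^sub>p"

inductive_set relevance_predicates :: "predicate set" where
  ident: "1\<^sub>p \<in> relevance_predicates"
| var: "A \<in> propositional_variables \<Longrightarrow> A \<in> relevance_predicates"
| disj: "A \<in> relevance_predicates \<Longrightarrow> B \<in> relevance_predicates \<Longrightarrow> A \<^bold>\<or> B \<in> relevance_predicates"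
| conj: "A \<in> relevance_predicates \<Longrightarrow> B \<in> relevance_predicates \<Longrightarrow> A \<^bold>\<and> B \<in> relevance_predicates"
| neg: "A \<in> relevance_predicates \<Longrightarrow> \<^bold>\<sim>A \<in> relevance_predicates"
| arrow: "A \<in> relevance_predicates \<Longrightarrow> B \<in> relevance_predicates \<Longrightarrow> A \<^bold>\<rightarrow> B \<in> relevance_predicates"
| fusion: "A \<in> relevance_predicates \<Longrightarrow> B \<in> relevance_predicates \<Longrightarrow> A \<^bold>\<circ> B \<in> relevance_predicates"
| truth: "\<^bold>t \<in> relevance_predicates"


section \<open>Algebras\<close>

record 'a ra =
  carrier :: "'a set"
  join :: "'a \<Rightarrow> 'a \<Rightarrow> 'a"
  cmpl :: "'a \<Rightarrow> 'a"
  relp :: "'a \<Rightarrow> 'a \<Rightarrow> 'a"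
  conv :: "'a \<Rightarrow> 'a"
  ident :: 'a

definition is_algebra :: "'a ra \<Rightarrow> bool" where
  "is_algebra \<AA> \<longleftrightarrow>
     (\<forall>x\<in>carrier \<AA>. \<forall>y\<in>carrier \<AA>. join \<AA> x y \<in> carrier \<AA> \<and> relp \<AA> x y \<in> carrier \<AA>) \<and>
     (\<forall>x\<in>carrier \<AA>. cmpl \<AA> x \<in> carrier \<AA> \<and> conv \<AA> x \<in> carrier \<AA>) \<and>
     ident \<AA> \<in> carrier \<AA>"

definition homomorphism :: "'a ra \<Rightarrow> 'b ra \<Rightarrow> ('a \<Rightarrow> 'b) \<Rightarrow> bool" where
  "homomorphism \<AA> \<BB> h \<longleftrightarrow>
     (\<forall>x\<in>carrier \<AA>. h x \<in> carrier \<BB>) \<and>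
     (\<forall>x\<in>carrier \<AA>. \<forall>y\<in>carrier \<AA>. h (join \<AA> x y) = join \<BB> (h x) (h y) \<and>
                                   h (relp \<AA> x y) = relp \<BB> (h x) (h y)) \<and>
     (\<forall>x\<in>carrier \<AA>. h (cmpl \<AA> x) = cmpl \<BB> (h x) \<and> h (conv \<AA> x) = conv \<BB> (h x)) \<and>
     h (ident \<AA>) = ident \<BB>"

definition isomorphic :: "'a ra \<Rightarrow> 'b ra \<Rightarrow> bool" where
  "isomorphic \<AA> \<BB> \<longleftrightarrow> is_algebra \<AA> \<and> is_algebra \<BB> \<and>
     (\<exists>h. homomorphism \<AA> \<BB> h \<and> bij_betw h (carrier \<AA>) (carrier \<BB>))"

definition proper_relation_algebra :: "'u rel ra \<Rightarrow> bool" where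
  "proper_relation_algebra \<AA> \<longleftrightarrow> is_algebra \<AA> \<and>
     (\<exists>E\<in>carrier \<AA>. equiv (Field E) E \<and>
        (\<forall>X\<in>carrier \<AA>. X \<subseteq> E) \<and>
        (\<forall>X\<in>carrier \<AA>. \<forall>Y\<in>carrier \<AA>. join \<AA> X Y = X \<union> Y \<and> relp \<AA> X Y = X O Y) \<and>
        (\<forall>X\<in>carrier \<AA>. cmpl \<AA> X = E - X \<and> conv \<AA> X = X\<inverse>) \<and>
        ident \<AA> = {(x, y). x = y \<and> (x, x) \<in> E})"

text \<open>
  The base of a representation must live in a fixed type. By the downward Loewenheim-Skolem
  theorem, an algebra with elements in \<open>'a\<close> that is isomorphic to a proper relation algebra at all
  is isomorphic to one whose base has at most as many points as \<open>'a + nat\<close>, so this choice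
  loses no generality.
\<close>

definition representable :: "'a ra \<Rightarrow> bool" where
  "representable \<AA> \<longleftrightarrow> (\<exists>\<BB> :: ('a + nat) rel ra. proper_relation_algebra \<BB> \<and> isomorphic \<AA> \<BB>)"

definition dense_algebra :: "'a ra \<Rightarrow> bool" where
  "dense_algebra \<AA> \<longleftrightarrow> (\<forall>x\<in>carrier \<AA>. join \<AA> x (relp \<AA> x x) = relp \<AA> x x)"

definition commutative_algebra :: "'a ra \<Rightarrow> bool" where
  "commutative_algebra \<AA> \<longleftrightarrow> (\<forall>x\<in>carrier \<AA>. \<forall>y\<in>carrier \<AA>. relp \<AA> x y = relp \<AA> y x)"

definition predicate_algebra :: "predicate ra" where
  "predicate_algebra =
     \<lparr>carrier = UNIV, join = Sum, cmpl = Compl, relp = RelProd, conv = Conv, ident = 1\<^sub>p\<rparr>"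


section \<open>Frames\<close>

record 'k frame =
  points :: "'k set"
  acc :: "('k \<times> 'k \<times> 'k) set"
  star :: "'k \<Rightarrow> 'k"
  units :: "'k set"

definition is_frame :: "'k frame \<Rightarrow> bool" where
  "is_frame \<KK> \<longleftrightarrow> acc \<KK> \<subseteq> points \<KK> \<times> points \<KK> \<times> points \<KK> \<and>
     (\<forall>a\<in>points \<KK>. star \<KK> a \<in> points \<KK>) \<and> units \<KK> \<subseteq> points \<KK>"

definition complex_algebra :: "'k frame \<Rightarrow> 'k set ra" where
  "complex_algebra \<KK> =
     \<lparr>carrier = Pow (points \<KK>),
      join = (\<union>),
      cmpl = (\<lambda>X. points \<KK> - X),
      relp = (\<lambda>X Y. {z. \<exists>x\<in>X. \<exists>y\<in>Y. (x, y, z) \<in> acc \<KK>}),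
      conv = (\<lambda>X. star \<KK> ` X),
      ident = units \<KK>\<rparr>"

definition valid :: "'k frame \<Rightarrow> predicate \<Rightarrow> bool" where
  "valid \<KK> A \<longleftrightarrow>
     (\<forall>h. homomorphism predicate_algebra (complex_algebra \<KK>) h \<longrightarrow> units \<KK> \<subseteq> h A)"

text \<open>
  The postulates for \<open>CR\<^sup>*\<close>-frames are split in two because each of the two postulates that
  \<open>CR_star_frame\<close> adds to \<open>pre_CR_star_frame\<close> forces commutativity: the Pasch postulate
  with \<open>a = 0\<close> is commutativity of the accessibility relation (see
  \<open>CR_star_frame_commutative\<close> below), and in the frame of a relation algebra
  \<open>Rabc \<Leftrightarrow> Rac\<^sup>*b\<^sup>*\<close> is equivalent to commutativity.
\<close>

definition pre_CR_star_frame :: "'k frame \<Rightarrow> bool" where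
  "pre_CR_star_frame \<KK> \<longleftrightarrow> is_frame \<KK> \<and>
     (\<exists>o\<^sub>0. units \<KK> = {o\<^sub>0} \<and>
       (\<forall>a\<in>points \<KK>. \<forall>b\<in>points \<KK>. (o\<^sub>0, a, b) \<in> acc \<KK> \<longleftrightarrow> a = b)) \<and>
     (\<forall>a\<in>points \<KK>. (a, a, a) \<in> acc \<KK>) \<and>
     (\<forall>a\<in>points \<KK>. star \<KK> (star \<KK> a) = a)"

definition CR_star_frame :: "'k frame \<Rightarrow> bool" where
  "CR_star_frame \<KK> \<longleftrightarrow> pre_CR_star_frame \<KK> \<and>
     (\<forall>a\<in>points \<KK>. \<forall>b\<in>points \<KK>. \<forall>c\<in>points \<KK>. \<forall>d\<in>points \<KK>.
        (\<exists>x\<in>points \<KK>. (a, b, x) \<in> acc \<KK> \<and> (x, c, d) \<in> acc \<KK>) \<longleftrightarrow>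
        (\<exists>y\<in>points \<KK>. (a, c, y) \<in> acc \<KK> \<and> (y, b, d) \<in> acc \<KK>)) \<and>
     (\<forall>a\<in>points \<KK>. \<forall>b\<in>points \<KK>. \<forall>c\<in>points \<KK>.
        (a, b, c) \<in> acc \<KK> \<longleftrightarrow> (a, star \<KK> c, star \<KK> b) \<in> acc \<KK>)"

lemma CR_star_frame_commutative:
  assumes "CR_star_frame \<KK>"
  shows "commutative_algebra (complex_algebra \<KK>)"
proof -
  have pre: "pre_CR_star_frame \<KK>"
    using assms unfolding CR_star_frame_def by (rule conjunct1)
  note frame = pre[unfolded pre_CR_star_frame_def, THEN conjunct1, unfolded is_frame_def]
  have sub: "acc \<KK> \<subseteq> points \<KK> \<times> points \<KK> \<times> points \<KK>"
    using frame by (rule conjunct1)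
  obtain o\<^sub>0 where units: "units \<KK> = {o\<^sub>0}"
    and unit: "\<forall>a\<in>points \<KK>. \<forall>b\<in>points \<KK>. (o\<^sub>0, a, b) \<in> acc \<KK> \<longleftrightarrow> a = b"
    using pre[unfolded pre_CR_star_frame_def, THEN conjunct2, THEN conjunct1] by (elim exE conjE)
  have o: "o\<^sub>0 \<in> points \<KK>"
    using frame[THEN conjunct2, THEN conjunct2] units by simp
  note pasch = assms[unfolded CR_star_frame_def, THEN conjunct2, THEN conjunct1, rule_format]
  have swap: "(c, b, d) \<in> acc \<KK>" if "(b, c, d) \<in> acc \<KK>" for b c d
  proof -
    have mem: "b \<in> points \<KK>" "c \<in> points \<KK>" "d \<in> points \<KK>"
      using that sub by auto
    then have "\<exists>x\<in>points \<KK>. (o\<^sub>0, b, x) \<in> acc \<KK> \<and> (x, c, d) \<in> acc \<KK>"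
      using unit mem that by (intro bexI[of _ b]) simp_all
    then obtain y where "y \<in> points \<KK>" "(o\<^sub>0, c, y) \<in> acc \<KK>" "(y, b, d) \<in> acc \<KK>"
      using iffD1[OF pasch[OF o mem]] by fast
    then show ?thesis
      using unit mem by simp
  qed
  then have "{z. \<exists>x\<in>X. \<exists>y\<in>Y. (x, y, z) \<in> acc \<KK>} \<subseteq> {z. \<exists>x\<in>Y. \<exists>y\<in>X. (x, y, z) \<in> acc \<KK>}"
    for X Y
    by blast
  then show ?thesis
    unfolding commutative_algebra_def complex_algebra_def
    by (simp add: set_eq_subset)
qed

text \<open>
  The type argument is the type whose subsets serve as sets of points. A statement with a free
  type variable there covers frames of all sizes.
\<close>

definition CR_star :: "'k itself \<Rightarrow> predicate set" where
  "CR_star _ = {A. \<forall>\<KK> :: 'k frame. CR_star_frame \<KK> \<longrightarrow> valid \<KK> A}"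

definition R_logic :: "'k itself \<Rightarrow> predicate set" where
  "R_logic T = CR_star T \<inter> relevance_predicates"


section \<open>First-order provability\<close>

text \<open>
  The variable \<open>v\<^sub>i\<close> is represented by its index. The selector \<open>vars\<close>
  collects all variables occurring in a formula, including those in quantifiers, and the
  map function \<open>rename\<close> acts on all of them.
\<close>

datatype (vars: 'v) form =
    Atom 'v predicate 'v
  | Eqn predicate predicate          (infix \<open>\<doteq>\<close> 55)
  | Imp "'v form" "'v form"          (infixr \<open>\<^bold>\<Rightarrow>\<close> 40)
  | FNot "'v form"                    (\<open>\<^bold>\<not>_\<close> [50] 50)
  | Forall 'v "'v form"
  for map: rename

type_synonym fm = "nat form"

abbreviation FOr (infixr \<open>\<^bold>\<or>\<^sub>f\<close> 45) where "\<phi> \<^bold>\<or>\<^sub>f \<psi> \<equiv> \<^bold>\<not>\<phi> \<^bold>\<Rightarrow> \<psi>"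
abbreviation FAnd (infixr \<open>\<^bold>\<and>\<^sub>f\<close> 47) where "\<phi> \<^bold>\<and>\<^sub>f \<psi> \<equiv> \<^bold>\<not>(\<phi> \<^bold>\<Rightarrow> \<^bold>\<not>\<psi>)"
abbreviation FIff (infix \<open>\<^bold>\<Leftrightarrow>\<close> 35) where
  "\<phi> \<^bold>\<Leftrightarrow> \<psi> \<equiv> (\<phi> \<^bold>\<Rightarrow> \<psi>) \<^bold>\<and>\<^sub>f (\<psi> \<^bold>\<Rightarrow> \<phi>)"
abbreviation Exists where "Exists x \<phi> \<equiv> \<^bold>\<not>(Forall x (\<^bold>\<not>\<phi>))"

abbreviation Leq (infix \<open>\<le>\<^sub>p\<close> 55) where "A \<le>\<^sub>p B \<equiv> A \<^bold>+ B \<doteq> B"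

primrec free_vars :: "'v form \<Rightarrow> 'v set" where
  "free_vars (Atom x A y) = {x, y}"
| "free_vars (A \<doteq> B) = {}"
| "free_vars (\<phi> \<^bold>\<Rightarrow> \<psi>) = free_vars \<phi> \<union> free_vars \<psi>"
| "free_vars (\<^bold>\<not>\<phi>) = free_vars \<phi>"
| "free_vars (Forall x \<phi>) = free_vars \<phi> - {x}"

text \<open>Universal closure, the variable with the least index being quantified outermost.\<close>

definition closure :: "fm \<Rightarrow> fm" where
  "closure \<phi> = foldr Forall (sorted_list_of_set (free_vars \<phi>)) \<phi>"

definition interchange :: "nat \<Rightarrow> nat \<Rightarrow> fm \<Rightarrow> fm" where
  "interchange x y = rename (transpose x y)"

definition Vars :: "enat \<Rightarrow> nat set" where
  "Vars n = {i. enat i < n}"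

definition Forms :: "enat \<Rightarrow> fm set" where
  "Forms n = {\<phi>. vars \<phi> \<subseteq> Vars n}"

inductive_set axioms :: "enat \<Rightarrow> fm set" for n :: enat where
  syllogism: "\<phi> \<in> Forms n \<Longrightarrow> \<psi> \<in> Forms n \<Longrightarrow> \<xi> \<in> Forms n \<Longrightarrow>
    closure ((\<phi> \<^bold>\<Rightarrow> \<psi>) \<^bold>\<Rightarrow> ((\<psi> \<^bold>\<Rightarrow> \<xi>) \<^bold>\<Rightarrow> (\<phi> \<^bold>\<Rightarrow> \<xi>))) \<in> axioms n"
| clavius: "\<phi> \<in> Forms n \<Longrightarrow> closure ((\<^bold>\<not>\<phi> \<^bold>\<Rightarrow> \<phi>) \<^bold>\<Rightarrow> \<phi>) \<in> axioms n"
| explosion: "\<phi> \<in> Forms n \<Longrightarrow> \<psi> \<in> Forms n \<Longrightarrow>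
    closure (\<phi> \<^bold>\<Rightarrow> (\<^bold>\<not>\<phi> \<^bold>\<Rightarrow> \<psi>)) \<in> axioms n"
| all_commute: "\<phi> \<in> Forms n \<Longrightarrow> x \<in> Vars n \<Longrightarrow> y \<in> Vars n \<Longrightarrow>
    closure (Forall x (Forall y \<phi>) \<^bold>\<Rightarrow> Forall y (Forall x \<phi>)) \<in> axioms n"
| all_distrib: "\<phi> \<in> Forms n \<Longrightarrow> \<psi> \<in> Forms n \<Longrightarrow> x \<in> Vars n \<Longrightarrow>
    closure (Forall x (\<phi> \<^bold>\<Rightarrow> \<psi>) \<^bold>\<Rightarrow> (Forall x \<phi> \<^bold>\<Rightarrow> Forall x \<psi>)) \<in> axioms n"
| all_elim: "\<phi> \<in> Forms n \<Longrightarrow> x \<in> Vars n \<Longrightarrow> closure (Forall x \<phi> \<^bold>\<Rightarrow> \<phi>) \<in> axioms n"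
| all_vacuous: "\<phi> \<in> Forms n \<Longrightarrow> x \<in> Vars n \<Longrightarrow> x \<notin> free_vars \<phi> \<Longrightarrow>
    closure (\<phi> \<^bold>\<Rightarrow> Forall x \<phi>) \<in> axioms n"
| ex_equal: "x \<in> Vars n \<Longrightarrow> y \<in> Vars n \<Longrightarrow> x \<noteq> y \<Longrightarrow>
    closure (Exists x (Atom x 1\<^sub>p y)) \<in> axioms n"
| leibniz_finite: "n < \<infinity> \<Longrightarrow> \<phi> \<in> Forms n \<Longrightarrow> x \<in> Vars n \<Longrightarrow> y \<in> Vars n \<Longrightarrow>
    closure (Atom x 1\<^sub>p y \<^bold>\<Rightarrow> (\<phi> \<^bold>\<Rightarrow> interchange x y \<phi>)) \<in> axioms n"
| leibniz_left: "n = \<infinity> \<Longrightarrow>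
    closure (Atom x 1\<^sub>p y \<^bold>\<Rightarrow> (Atom x A z \<^bold>\<Rightarrow> Atom y A z)) \<in> axioms n"
| leibniz_right: "n = \<infinity> \<Longrightarrow>
    closure (Atom x 1\<^sub>p y \<^bold>\<Rightarrow> (Atom z A x \<^bold>\<Rightarrow> Atom z A y)) \<in> axioms n"
| sum: "closure (Atom 0 (A \<^bold>+ B) 1 \<^bold>\<Leftrightarrow> Atom 0 A 1 \<^bold>\<or>\<^sub>f Atom 0 B 1) \<in> axioms n"
| compl: "closure (Atom 0 (\<^bold>-A) 1 \<^bold>\<Leftrightarrow> \<^bold>\<not>(Atom 0 A 1)) \<in> axioms n"
| relprod: "closure (Atom 0 (A \<^bold>; B) 1 \<^bold>\<Leftrightarrow> Exists 2 (Atom 0 A 2 \<^bold>\<and>\<^sub>f Atom 2 B 1)) \<in> axioms n"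
| conv: "closure (Atom 0 (A\<^sup>\<smile>) 1 \<^bold>\<Leftrightarrow> Atom 1 A 0) \<in> axioms n"
| equation: "(A \<doteq> B \<^bold>\<Leftrightarrow> closure (Atom 0 A 1 \<^bold>\<Leftrightarrow> Atom 0 B 1)) \<in> axioms n"

inductive provable :: "enat \<Rightarrow> fm set \<Rightarrow> fm \<Rightarrow> bool" for n :: enat and \<Psi> :: "fm set" where
  hyp: "\<phi> \<in> \<Psi> \<Longrightarrow> provable n \<Psi> \<phi>"
| ax: "\<phi> \<in> axioms n \<Longrightarrow> provable n \<Psi> \<phi>"
| mp: "provable n \<Psi> (\<phi> \<^bold>\<Rightarrow> \<psi>) \<Longrightarrow> provable n \<Psi> \<phi> \<Longrightarrow> provable n \<Psi> \<psi>"

definition density :: "fm set" where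
  "density = {A \<le>\<^sub>p A \<^bold>; A |A. True}"

definition commutativity :: "fm set" where
  "commutativity = {A \<^bold>; B \<doteq> B \<^bold>; A |A B. True}"

definition TR :: "predicate set" where
  "TR = {A. provable 4 (density \<union> commutativity) (1\<^sub>p \<le>\<^sub>p A)}"

definition CT_omega :: "predicate set" where
  "CT_omega = {A. provable \<infinity> {} (1\<^sub>p \<le>\<^sub>p A)}"


section \<open>Sequent calculus\<close>

type_synonym atom = "nat \<times> predicate \<times> nat"

text \<open>
  The sequents derivable in the calculus from a set of equations. Sides of sequents are arbitrary,
  possibly infinite, sets.
\<close>

inductive derivable :: "fm set \<Rightarrow> atom set \<Rightarrow> atom set \<Rightarrow> bool" for \<Xi> :: "fm set" where
  axiom_common: "\<Gamma> \<inter> \<Delta> \<noteq> {} \<Longrightarrow> derivable \<Xi> \<Gamma> \<Delta>"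
| axiom_ident: "(x, 1\<^sub>p, x) \<in> \<Delta> \<Longrightarrow> derivable \<Xi> \<Gamma> \<Delta>"
| equation_lr: "X \<doteq> Y \<in> \<Xi> \<Longrightarrow> derivable \<Xi> (insert (i, X, j) \<Gamma>) (insert (i, Y, j) \<Delta>)"
| equation_rl: "X \<doteq> Y \<in> \<Xi> \<Longrightarrow> derivable \<Xi> (insert (i, Y, j) \<Gamma>) (insert (i, X, j) \<Delta>)"
| cut: "derivable \<Xi> \<Gamma> (insert (x, A, y) \<Delta>) \<Longrightarrow> derivable \<Xi> (insert (x, A, y) \<Gamma>') \<Delta>' \<Longrightarrow>
    derivable \<Xi> (\<Gamma> \<union> \<Gamma>') (\<Delta> \<union> \<Delta>')"
| equality: "derivable \<Xi> (insert (x, A, y) \<Gamma>) \<Delta> \<Longrightarrow>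
    derivable \<Xi> (insert (x, A, z) (insert (z, 1\<^sub>p, y) \<Gamma>)) \<Delta>"
| sum_left: "derivable \<Xi> (insert (x, A, y) \<Gamma>) \<Delta> \<Longrightarrow> derivable \<Xi> (insert (x, B, y) \<Gamma>') \<Delta>' \<Longrightarrow>
    derivable \<Xi> (insert (x, A \<^bold>+ B, y) (\<Gamma> \<union> \<Gamma>')) (\<Delta> \<union> \<Delta>')"
| sum_right: "derivable \<Xi> \<Gamma> (insert (x, A, y) (insert (x, B, y) \<Delta>)) \<Longrightarrow>
    derivable \<Xi> \<Gamma> (insert (x, A \<^bold>+ B, y) \<Delta>)"
| compl_left: "derivable \<Xi> \<Gamma> (insert (x, A, y) \<Delta>) \<Longrightarrow>
    derivable \<Xi> (insert (x, \<^bold>-A, y) \<Gamma>) \<Delta>"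
| compl_right: "derivable \<Xi> (insert (x, A, y) \<Gamma>) \<Delta> \<Longrightarrow>
    derivable \<Xi> \<Gamma> (insert (x, \<^bold>-A, y) \<Delta>)"
| relprod_left: "derivable \<Xi> (insert (x, A, y) (insert (y, B, z) \<Gamma>)) \<Delta> \<Longrightarrow> y \<noteq> x \<Longrightarrow> y \<noteq> z \<Longrightarrow>
    (\<forall>(u, C, w) \<in> \<Gamma> \<union> \<Delta>. u \<noteq> y \<and> w \<noteq> y) \<Longrightarrow>
    derivable \<Xi> (insert (x, A \<^bold>; B, z) \<Gamma>) \<Delta>"
| relprod_right: "derivable \<Xi> \<Gamma> (insert (x, A, y) \<Delta>) \<Longrightarrow> derivable \<Xi> \<Gamma>' (insert (y, B, z) \<Delta>') \<Longrightarrow>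
    derivable \<Xi> (\<Gamma> \<union> \<Gamma>') (insert (x, A \<^bold>; B, z) (\<Delta> \<union> \<Delta>'))"
| conv_left: "derivable \<Xi> (insert (x, A, y) \<Gamma>) \<Delta> \<Longrightarrow>
    derivable \<Xi> (insert (y, A\<^sup>\<smile>, x) \<Gamma>) \<Delta>"
| conv_right: "derivable \<Xi> \<Gamma> (insert (x, A, y) \<Delta>) \<Longrightarrow>
    derivable \<Xi> \<Gamma> (insert (y, A\<^sup>\<smile>, x) \<Delta>)"

definition omega_provable :: "fm set \<Rightarrow> predicate \<Rightarrow> bool" where
  "omega_provable \<Xi> A \<longleftrightarrow> derivable \<Xi> {} {(0, A, 0)}"

end

theory Submission
  imports Defs
begin

text \<open>
  Via residuation, each of the five theorems reduces to an inequality between relative products that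
  follows from commutativity, associativity, \<open>A ; (A \<rightarrow> B) \<le> B\<close> and, for the fifth, density. In a
  \<open>CR\<^sup>*\<close>-frame the same arguments apply to the accessibility relation conjugated by the star.

  For the negative part, consider a dense tree with linearly ordered branching, in which any two
  distinct nodes are related by exactly one of \<open>above\<close>, \<open>below\<close>, \<open>left of\<close>, \<open>right of\<close>. The unions
  of these four relations and of equality form a finite proper relation algebra. Each of its atoms is
  included in its square, so it is dense. It is not commutative, because any two nodes have a common
  lower bound but incomparable nodes have no common upper bound. Interpreting \<open>A\<close>, \<open>B\<close>, \<open>C\<close> as
  \<open>left of\<close>, \<open>left of or above\<close>, \<open>left of\<close> refutes all five predicates.
\<close>

section \<open>First-order provability\<close>

text \<open>Modus ponens is the only rule, every axiom is a closure over exactly the variables free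
  in it, and the axioms for the relational operators speak of v0, v1, v2 alone. Generalization,
  tautologies and instances at other variables must therefore be derived before relation algebra can
  begin. Renaming is possible only by interchange, and only while some variable is not free. So
  inclusions are kept in two free variables, and only the proofs of associativity name all four.

  In the negative part the density equations have to hold in the countermodel, so the failure must
  come from commutativity alone. One finite table serves all refutations: once its entries are known
  to be exactly the compositions realized among nodes, representability, both soundness refutations
  and invalidity in the frame become computations with five numbers. Rational levels without a least
  or greatest one, and integer labels unbounded in both directions, provide the nodes that realize
  every entry.\<close>

lemma finite_vars: "finite (vars \<phi>)"
  by (induction \<phi>) auto

lemma free_vars_subset_vars: "free_vars \<phi> \<subseteq> vars \<phi>"
  by (induction \<phi>) auto

lemma finite_free_vars [simp]: "finite (free_vars \<phi>)"
  using finite_vars free_vars_subset_vars finite_subset by metis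

lemma Forms_simps [simp]:
  "Atom x A y \<in> Forms n \<longleftrightarrow> x \<in> Vars n \<and> y \<in> Vars n"
  "A \<doteq> B \<in> Forms n"
  "(\<phi> \<^bold>\<Rightarrow> \<psi>) \<in> Forms n \<longleftrightarrow> \<phi> \<in> Forms n \<and> \<psi> \<in> Forms n"
  "(\<^bold>\<not>\<phi>) \<in> Forms n \<longleftrightarrow> \<phi> \<in> Forms n"
  "Forall x \<phi> \<in> Forms n \<longleftrightarrow> x \<in> Vars n \<and> \<phi> \<in> Forms n"
  by (auto simp: Forms_def)

lemma free_vars_Forms: "\<phi> \<in> Forms n \<Longrightarrow> free_vars \<phi> \<subseteq> Vars n"
  using free_vars_subset_vars[of \<phi>] by (auto simp: Forms_def)

abbreviation alls :: "nat list \<Rightarrow> fm \<Rightarrow> fm" where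
  "alls xs \<phi> \<equiv> foldr Forall xs \<phi>"

lemma alls_Forms [simp]: "alls xs \<phi> \<in> Forms n \<longleftrightarrow> set xs \<subseteq> Vars n \<and> \<phi> \<in> Forms n"
  by (induction xs) auto

lemma free_vars_alls [simp]: "free_vars (alls xs \<phi>) = free_vars \<phi> - set xs"
  by (induction xs) auto

lemma sorted_list_of_set_eqI:
  "sorted xs \<Longrightarrow> distinct xs \<Longrightarrow> set xs = V \<Longrightarrow> sorted_list_of_set V = xs"
  by (auto simp: sorted_list_of_set.idem_if_sorted_distinct)

lemma closure_eqI:
  "sorted xs \<Longrightarrow> distinct xs \<Longrightarrow> set xs = free_vars \<phi> \<Longrightarrow> closure \<phi> = alls xs \<phi>"
  unfolding closure_def by (simp add: sorted_list_of_set_eqI)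

lemma closure_closed: "free_vars \<phi> = {} \<Longrightarrow> closure \<phi> = \<phi>"
  by (simp add: closure_def)

lemma sorted_list_of_set_split:
  fixes V :: "nat set"
  assumes "finite V" "y \<in> V"
  obtains xs zs where "sorted_list_of_set V = xs @ y # zs"
    "\<forall>x\<in>set xs. x < y" "\<forall>z\<in>set zs. y < z" "set xs \<union> set zs = V - {y}"
    "sorted (xs @ y # zs)" "distinct (xs @ y # zs)"
proof -
  obtain xs zs where eq: "sorted_list_of_set V = xs @ y # zs"
    using assms by (metis set_sorted_list_of_set split_list)
  have s: "sorted (xs @ y # zs)" "distinct (xs @ y # zs)" "set (xs @ y # zs) = V"
    using assms eq by (metis sorted_sorted_list_of_set distinct_sorted_list_of_set set_sorted_list_of_set)+
  have "\<forall>x\<in>set xs. x < y" "\<forall>z\<in>set zs. y < z"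
    using s(1,2) by (auto simp: sorted_append order.strict_iff_order)
  moreover have "set xs \<union> set zs = V - {y}"
    using s(2,3) by auto
  ultimately show ?thesis
    using that eq s(1,2) by blast
qed

section \<open>Quantifier blocks, modus ponens under closures, generalization\<close>

locale first_order_system =
  fixes n :: enat and \<Psi> :: "fm set"
begin

text \<open>Induction peels off the innermost quantifier, because the distribution axiom treats a
  single quantifier under a closure. As the block binds exactly the variables free in one of the two
  formulas, its outer part coincides with that closure. The induction hypothesis is applied twice,
  once for each outer arrow of the axiom.\<close>

lemma provable_alls_mp:
  assumes "provable n \<Psi> (alls xs (\<phi> \<^bold>\<Rightarrow> \<psi>))" "provable n \<Psi> (alls xs \<phi>)"
    and "sorted xs" "distinct xs" "set xs = free_vars \<phi> \<union> free_vars \<psi>"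
    and "\<phi> \<in> Forms n" "\<psi> \<in> Forms n"
  shows "provable n \<Psi> (alls xs \<psi>)"
  using assms
proof (induction xs arbitrary: \<phi> \<psi> rule: rev_induct)
  case Nil
  then show ?case
    using provable.mp by auto
next
  case (snoc y xs)
  let ?a = "Forall y (\<phi> \<^bold>\<Rightarrow> \<psi>)" and ?b = "Forall y \<phi>" and ?c = "Forall y \<psi>"
  have "y \<in> Vars n"
    using snoc.prems free_vars_Forms by fastforce
  then have F: "?a \<in> Forms n" "?b \<in> Forms n" "?c \<in> Forms n"
    using snoc.prems by auto
  have s: "sorted xs" "distinct xs" "y \<notin> set xs"
    using snoc.prems by (auto simp: sorted_append)
  have fv: "set xs = free_vars \<phi> \<union> free_vars \<psi> - {y}"
    using snoc.prems(5) s by auto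
  have "closure (?a \<^bold>\<Rightarrow> (?b \<^bold>\<Rightarrow> ?c)) = alls xs (?a \<^bold>\<Rightarrow> (?b \<^bold>\<Rightarrow> ?c))"
    using s fv by (intro closure_eqI) auto
  then have "provable n \<Psi> (alls xs (?a \<^bold>\<Rightarrow> (?b \<^bold>\<Rightarrow> ?c)))"
    using axioms.all_distrib[of \<phi> n \<psi> y] provable.ax snoc.prems(6,7) \<open>y \<in> Vars n\<close> by metis
  then have "provable n \<Psi> (alls xs (?b \<^bold>\<Rightarrow> ?c))"
    using snoc.prems s fv F by (intro snoc.IH[of ?a "?b \<^bold>\<Rightarrow> ?c"]) auto
  then show ?case
    using snoc.prems s fv F snoc.IH[of ?b ?c] by auto
qed

text \<open>
  Closures quantify only over the variables that are free, so a vacuous quantifier has to be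
  inserted or removed in the middle of a block. Treating the least vacuous variable makes the
  variables outside it exactly the free ones of the rest, whence the required implication is an
  axiom.
\<close>

lemma provable_alls_vacuous:
  assumes "\<phi> \<in> Forms n" "finite V" "free_vars \<phi> \<subseteq> V" "V \<subseteq> Vars n"
  shows "provable n \<Psi> (alls (sorted_list_of_set V) \<phi>) \<longleftrightarrow> provable n \<Psi> (closure \<phi>)"
  using assms
proof (induction "card (V - free_vars \<phi>)" arbitrary: V)
  case 0
  then have "V = free_vars \<phi>"
    by auto
  then show ?case
    by (simp add: closure_def)
next
  case (Suc k)
  let ?W = "V - free_vars \<phi>"
  define y where "y = Min ?W"
  have fin: "finite ?W" "?W \<noteq> {}"
    using Suc by (auto simp: card_gt_0_iff dest: arg_cong[where f = "\<lambda>k. 0 < k"])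
  then have y: "y \<in> V" "y \<notin> free_vars \<phi>"
    using Min_in unfolding y_def by blast+
  have least: "x \<in> free_vars \<phi>" if "x \<in> V" "x < y" for x
    using that fin Min_le[of ?W x] unfolding y_def by force
  obtain xs zs where split: "sorted_list_of_set V = xs @ y # zs"
    "\<forall>x\<in>set xs. x < y" "\<forall>z\<in>set zs. y < z" "set xs \<union> set zs = V - {y}"
    "sorted (xs @ y # zs)" "distinct (xs @ y # zs)"
    using sorted_list_of_set_split[OF Suc.prems(2) y(1)] by metis
  let ?\<chi> = "alls zs \<phi>"
  have xs: "set xs = free_vars ?\<chi>"
    using split(2,3,4,6) least Suc.prems(3) y(2) by auto
  have sxs: "sorted xs" "distinct xs"
    using split(5,6) by (auto simp: sorted_append)
  have F: "?\<chi> \<in> Forms n" "Forall y ?\<chi> \<in> Forms n" "y \<in> Vars n"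
    using Suc.prems split(4) y by auto
  have ynot: "y \<notin> free_vars ?\<chi>"
    using y by simp
  have "closure (?\<chi> \<^bold>\<Rightarrow> Forall y ?\<chi>) = alls xs (?\<chi> \<^bold>\<Rightarrow> Forall y ?\<chi>)"
    using xs sxs by (intro closure_eqI) auto
  then have 1: "provable n \<Psi> (alls xs (?\<chi> \<^bold>\<Rightarrow> Forall y ?\<chi>))"
    using axioms.all_vacuous[OF F(1,3) ynot] provable.ax by metis
  have "closure (Forall y ?\<chi> \<^bold>\<Rightarrow> ?\<chi>) = alls xs (Forall y ?\<chi> \<^bold>\<Rightarrow> ?\<chi>)"
    using xs sxs by (intro closure_eqI) auto
  then have 2: "provable n \<Psi> (alls xs (Forall y ?\<chi> \<^bold>\<Rightarrow> ?\<chi>))"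
    using axioms.all_elim[OF F(1,3)] provable.ax by metis
  have fvs: "set xs = free_vars ?\<chi> \<union> free_vars (Forall y ?\<chi>)"
    "set xs = free_vars (Forall y ?\<chi>) \<union> free_vars ?\<chi>"
    using xs by auto
  have "provable n \<Psi> (alls xs ?\<chi>) \<longleftrightarrow> provable n \<Psi> (alls xs (Forall y ?\<chi>))"
    using provable_alls_mp[OF 1 _ sxs fvs(1) F(1,2)] provable_alls_mp[OF 2 _ sxs fvs(2) F(2,1)]
    by blast
  moreover have "sorted_list_of_set (V - {y}) = xs @ zs"
    using split by (intro sorted_list_of_set_eqI) (auto simp: sorted_append)
  moreover have "provable n \<Psi> (alls (sorted_list_of_set (V - {y})) \<phi>) \<longleftrightarrow>
    provable n \<Psi> (closure \<phi>)"
  proof (rule Suc.hyps(1))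
    have "V - {y} - free_vars \<phi> = ?W - {y}"
      by auto
    then show "k = card (V - {y} - free_vars \<phi>)"
      using Suc.hyps(2) fin(1) y by simp
  qed (use Suc.prems y in auto)
  ultimately show ?case
    using split(1) by simp
qed

text \<open>Open formulas are handled through their closures, so that the calculus can be used with
  free variables. Membership in \<open>Forms n\<close> is carried along because the axiom schemata
  demand it.\<close>

definition Th :: "fm \<Rightarrow> bool" where
  "Th \<phi> \<longleftrightarrow> \<phi> \<in> Forms n \<and> provable n \<Psi> (closure \<phi>)"

lemma Th_Forms: "Th \<phi> \<Longrightarrow> \<phi> \<in> Forms n"
  by (simp add: Th_def)

lemma Th_axiom: "closure \<phi> \<in> axioms n \<Longrightarrow> \<phi> \<in> Forms n \<Longrightarrow> Th \<phi>"
  by (simp add: Th_def provable.ax)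

text \<open>The closures of the implication and of its two parts bind different variables. The
  antecedent is padded to the variables of the implication, where the block version applies, and the
  consequent is stripped of surplus quantifiers afterwards.\<close>

lemma Th_mp:
  assumes "Th (\<phi> \<^bold>\<Rightarrow> \<psi>)" "Th \<phi>"
  shows "Th \<psi>"
proof -
  let ?V = "free_vars \<phi> \<union> free_vars \<psi>"
  let ?xs = "sorted_list_of_set ?V"
  have F: "\<phi> \<in> Forms n" "\<psi> \<in> Forms n"
    using assms unfolding Th_def by auto
  have V: "finite ?V" "?V \<subseteq> Vars n"
    using F free_vars_Forms by auto
  have "provable n \<Psi> (alls ?xs (\<phi> \<^bold>\<Rightarrow> \<psi>))"
    using assms(1) by (simp add: Th_def closure_def)
  moreover have "provable n \<Psi> (alls ?xs \<phi>)"
    using provable_alls_vacuous[OF F(1) V(1) _ V(2)] assms(2) by (simp add: Th_def)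
  ultimately have "provable n \<Psi> (alls ?xs \<psi>)"
    using F V by (intro provable_alls_mp[of ?xs \<phi> \<psi>]) auto
  then show ?thesis
    using provable_alls_vacuous[OF F(2) V(1) _ V(2)] F by (simp add: Th_def)
qed

text \<open>Generalization over a free variable is a reordering: x stands somewhere in the sorted
  block and has to become innermost. It passes the later variables one at a time by the axiom
  commuting two quantifiers, and at each stage the block outside them is a closure.\<close>

lemma provable_alls_inward:
  assumes "provable n \<Psi> (alls (ys @ x # zs) \<phi>)" "sorted (ys @ zs)" "distinct (ys @ x # zs)"
    and "free_vars \<phi> = set (ys @ x # zs)" "\<phi> \<in> Forms n"
  shows "provable n \<Psi> (alls (ys @ zs) (Forall x \<phi>))"
  using assms
proof (induction zs arbitrary: ys)
  case Nil
  then show ?case by simp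
next
  case (Cons z zs)
  let ?\<chi> = "alls zs \<phi>"
  let ?a = "Forall x (Forall z ?\<chi>)" and ?b = "Forall z (Forall x ?\<chi>)"
  have V: "x \<in> Vars n" "z \<in> Vars n" "set zs \<subseteq> Vars n"
    using free_vars_Forms[OF Cons.prems(5)] Cons.prems(4) by auto
  have s: "sorted ys" "distinct ys" "set ys = free_vars ?a" "set ys = free_vars ?b"
    using Cons.prems by (auto simp: sorted_append)
  have "closure (?a \<^bold>\<Rightarrow> ?b) = alls ys (?a \<^bold>\<Rightarrow> ?b)"
    using s by (intro closure_eqI) auto
  then have "provable n \<Psi> (alls ys (?a \<^bold>\<Rightarrow> ?b))"
    using axioms.all_commute[of ?\<chi> n x z] provable.ax V Cons.prems(5) by (metis alls_Forms)
  moreover have "provable n \<Psi> (alls ys ?a)" "?a \<in> Forms n" "?b \<in> Forms n"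
    using Cons.prems(1,5) V by auto
  ultimately have "provable n \<Psi> (alls ys ?b)"
    using provable_alls_mp s by (metis Un_absorb)
  then have "provable n \<Psi> (alls ((ys @ [z]) @ x # zs) \<phi>)"
    by simp
  then have "provable n \<Psi> (alls ((ys @ [z]) @ zs) (Forall x \<phi>))"
    using Cons.prems(2-5) by (intro Cons.IH) auto
  then show ?case
    by simp
qed

text \<open>There is no rule of generalization. A vacuous quantifier comes from its axiom; for a
  free x the closure already contains the quantifier, only at the wrong depth.\<close>

lemma Th_gen:
  assumes "Th \<phi>" "x \<in> Vars n"
  shows "Th (Forall x \<phi>)"
proof (cases "x \<in> free_vars \<phi>")
  case False
  then have "Th (\<phi> \<^bold>\<Rightarrow> Forall x \<phi>)"
    using assms Th_Forms[OF assms(1)] by (intro Th_axiom axioms.all_vacuous) auto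
  then show ?thesis
    using Th_mp assms by blast
next
  case True
  then obtain xs zs where split: "sorted_list_of_set (free_vars \<phi>) = xs @ x # zs"
    "set xs \<union> set zs = free_vars \<phi> - {x}" "sorted (xs @ x # zs)" "distinct (xs @ x # zs)"
    using sorted_list_of_set_split[OF finite_free_vars True] by metis
  then have "closure (Forall x \<phi>) = alls (xs @ zs) (Forall x \<phi>)"
    by (intro closure_eqI) (auto simp: sorted_append)
  moreover have "provable n \<Psi> (alls (xs @ zs) (Forall x \<phi>))"
    using assms(1) split True
    by (intro provable_alls_inward) (auto simp: Th_def closure_def sorted_append)
  ultimately show ?thesis
    using assms by (simp add: Th_def)
qed

lemma Th_closed: "Th \<phi> \<Longrightarrow> free_vars \<phi> = {} \<Longrightarrow> provable n \<Psi> \<phi>"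
  by (simp add: Th_def closure_closed)

lemma Th_hyp: "\<phi> \<in> \<Psi> \<Longrightarrow> free_vars \<phi> = {} \<Longrightarrow> \<phi> \<in> Forms n \<Longrightarrow> Th \<phi>"
  by (simp add: Th_def closure_closed provable.hyp)

lemma free_vars_closure [simp]: "free_vars (closure \<phi>) = {}"
  by (simp add: closure_def)

lemma Th_closure_iff: "\<phi> \<in> Forms n \<Longrightarrow> Th (closure \<phi>) \<longleftrightarrow> Th \<phi>"
  using free_vars_Forms by (auto simp: Th_def closure_closed) (auto simp: closure_def)

section \<open>Implicational calculus from Lukasiewicz's three axioms\<close>

lemma Th_syllogism: "\<phi> \<in> Forms n \<Longrightarrow> \<psi> \<in> Forms n \<Longrightarrow> \<xi> \<in> Forms n \<Longrightarrow>
    Th ((\<phi> \<^bold>\<Rightarrow> \<psi>) \<^bold>\<Rightarrow> ((\<psi> \<^bold>\<Rightarrow> \<xi>) \<^bold>\<Rightarrow> (\<phi> \<^bold>\<Rightarrow> \<xi>)))"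
  by (intro Th_axiom axioms.syllogism) auto

lemma Th_clavius: "\<phi> \<in> Forms n \<Longrightarrow> Th ((\<^bold>\<not>\<phi> \<^bold>\<Rightarrow> \<phi>) \<^bold>\<Rightarrow> \<phi>)"
  by (intro Th_axiom axioms.clavius) auto

lemma Th_explosion: "\<phi> \<in> Forms n \<Longrightarrow> \<psi> \<in> Forms n \<Longrightarrow> Th (\<phi> \<^bold>\<Rightarrow> (\<^bold>\<not>\<phi> \<^bold>\<Rightarrow> \<psi>))"
  by (intro Th_axiom axioms.explosion) auto

lemma Th_trans:
  assumes "Th (\<phi> \<^bold>\<Rightarrow> \<psi>)" "Th (\<psi> \<^bold>\<Rightarrow> \<xi>)"
  shows "Th (\<phi> \<^bold>\<Rightarrow> \<xi>)"
proof -
  have "\<phi> \<in> Forms n" "\<psi> \<in> Forms n" "\<xi> \<in> Forms n"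
    using assms[THEN Th_Forms] by simp_all
  then show ?thesis
    using Th_mp[OF Th_mp[OF Th_syllogism]] assms by blast
qed

lemma Th_suffix: "Th (\<phi> \<^bold>\<Rightarrow> \<psi>) \<Longrightarrow> \<xi> \<in> Forms n \<Longrightarrow> Th ((\<psi> \<^bold>\<Rightarrow> \<xi>) \<^bold>\<Rightarrow> (\<phi> \<^bold>\<Rightarrow> \<xi>))"
  by (rule Th_mp[OF Th_syllogism]) (auto dest: Th_Forms)

text \<open>Common source of weakening, contraction and contraposition: the premise and explosion
  give that \<open>\<psi>\<close> implies (\<open>\<phi>\<close> implies \<open>\<xi>\<close>), and
  \<open>\<theta>\<close> is then suffixed. In the applications the middle formula is a Clavius
  instance, which \<open>Th_clavius_elim\<close> discards.\<close>

lemma Th_contrapos_suffix: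
  assumes "\<phi> \<in> Forms n" "\<psi> \<in> Forms n" "\<xi> \<in> Forms n" "\<theta> \<in> Forms n"
  shows "Th ((\<phi> \<^bold>\<Rightarrow> \<^bold>\<not>\<psi>) \<^bold>\<Rightarrow> (((\<phi> \<^bold>\<Rightarrow> \<xi>) \<^bold>\<Rightarrow> \<theta>) \<^bold>\<Rightarrow> (\<psi> \<^bold>\<Rightarrow> \<theta>)))"
proof -
  have "Th ((\<phi> \<^bold>\<Rightarrow> \<^bold>\<not>\<psi>) \<^bold>\<Rightarrow> ((\<^bold>\<not>\<psi> \<^bold>\<Rightarrow> \<xi>) \<^bold>\<Rightarrow> (\<phi> \<^bold>\<Rightarrow> \<xi>)))"
    using assms by (intro Th_syllogism) auto
  moreover have "Th (((\<^bold>\<not>\<psi> \<^bold>\<Rightarrow> \<xi>) \<^bold>\<Rightarrow> (\<phi> \<^bold>\<Rightarrow> \<xi>)) \<^bold>\<Rightarrow> (\<psi> \<^bold>\<Rightarrow> (\<phi> \<^bold>\<Rightarrow> \<xi>)))"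
    using assms by (intro Th_suffix Th_explosion) auto
  moreover have "Th ((\<psi> \<^bold>\<Rightarrow> (\<phi> \<^bold>\<Rightarrow> \<xi>)) \<^bold>\<Rightarrow> (((\<phi> \<^bold>\<Rightarrow> \<xi>) \<^bold>\<Rightarrow> \<theta>) \<^bold>\<Rightarrow> (\<psi> \<^bold>\<Rightarrow> \<theta>)))"
    using assms by (intro Th_syllogism) auto
  ultimately show ?thesis
    using Th_trans by blast
qed

lemma Th_explosion_suffix:
  assumes "\<phi> \<in> Forms n" "\<psi> \<in> Forms n" "\<xi> \<in> Forms n" "\<theta> \<in> Forms n"
  shows "Th (\<phi> \<^bold>\<Rightarrow> (((\<^bold>\<not>\<phi> \<^bold>\<Rightarrow> \<psi>) \<^bold>\<Rightarrow> \<xi>) \<^bold>\<Rightarrow> (\<theta> \<^bold>\<Rightarrow> \<xi>)))"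
  using assms by (intro Th_trans[OF Th_explosion[of \<phi> "\<^bold>\<not>\<theta>"] Th_contrapos_suffix]) auto

text \<open>Dropping a proved antecedent would normally use weakening, which is not yet available.
  Explosion at \<open>?B\<close> itself puts the negation of \<open>\<psi>\<close> in front of
  \<open>?B\<close>, and the Clavius axiom for \<open>\<psi>\<close> finishes.\<close>

lemma Th_clavius_elim:
  assumes "\<phi> \<in> Forms n" "\<psi> \<in> Forms n"
  shows "Th ((((\<^bold>\<not>\<phi> \<^bold>\<Rightarrow> \<phi>) \<^bold>\<Rightarrow> \<phi>) \<^bold>\<Rightarrow> \<psi>) \<^bold>\<Rightarrow> \<psi>)"
proof -
  let ?B = "(\<^bold>\<not>\<phi> \<^bold>\<Rightarrow> \<phi>) \<^bold>\<Rightarrow> \<phi>"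
  have "Th (?B \<^bold>\<Rightarrow> (((\<^bold>\<not>?B \<^bold>\<Rightarrow> ?B) \<^bold>\<Rightarrow> ?B) \<^bold>\<Rightarrow> (\<^bold>\<not>\<psi> \<^bold>\<Rightarrow> ?B)))"
    using assms by (intro Th_explosion_suffix) auto
  moreover have "Th ?B" "Th ((\<^bold>\<not>?B \<^bold>\<Rightarrow> ?B) \<^bold>\<Rightarrow> ?B)"
    using assms by (auto intro!: Th_clavius)
  ultimately have "Th (\<^bold>\<not>\<psi> \<^bold>\<Rightarrow> ?B)"
    using Th_mp by blast
  then have "Th ((?B \<^bold>\<Rightarrow> \<psi>) \<^bold>\<Rightarrow> (\<^bold>\<not>\<psi> \<^bold>\<Rightarrow> \<psi>))"
    using assms Th_suffix by blast
  then show ?thesis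
    using assms Th_clavius Th_trans by blast
qed

lemma Th_K: "\<phi> \<in> Forms n \<Longrightarrow> \<psi> \<in> Forms n \<Longrightarrow> Th (\<phi> \<^bold>\<Rightarrow> (\<psi> \<^bold>\<Rightarrow> \<phi>))"
  by (intro Th_trans[OF Th_explosion_suffix[of \<phi> \<phi> \<phi> \<psi>] Th_clavius_elim]) auto

text \<open>Peirce's law for \<open>?i\<close> in disguise: the hypothesis, suffixed by
  \<open>\<psi>\<close>, says that (\<open>?i\<close> implies \<open>\<psi>\<close>) implies
  \<open>?i\<close>. The law itself holds because the negation of \<open>?i\<close> implies
  (\<open>?i\<close> implies \<open>\<psi>\<close>), whereupon Clavius applies.\<close>

lemma Th_contraction:
  assumes "\<phi> \<in> Forms n" "\<psi> \<in> Forms n"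
  shows "Th ((\<phi> \<^bold>\<Rightarrow> (\<phi> \<^bold>\<Rightarrow> \<psi>)) \<^bold>\<Rightarrow> (\<phi> \<^bold>\<Rightarrow> \<psi>))"
proof -
  let ?i = "\<phi> \<^bold>\<Rightarrow> \<psi>"
  have i: "?i \<in> Forms n"
    using assms by simp
  have "Th (\<^bold>\<not>?i \<^bold>\<Rightarrow> (\<^bold>\<not>\<psi> \<^bold>\<Rightarrow> \<^bold>\<not>?i))"
    using assms by (intro Th_K) auto
  moreover have "Th ((\<^bold>\<not>\<psi> \<^bold>\<Rightarrow> \<^bold>\<not>?i) \<^bold>\<Rightarrow> (((\<^bold>\<not>\<psi> \<^bold>\<Rightarrow> \<psi>) \<^bold>\<Rightarrow> \<psi>) \<^bold>\<Rightarrow> (?i \<^bold>\<Rightarrow> \<psi>)))"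
    using assms by (intro Th_contrapos_suffix) auto
  moreover have "Th ((((\<^bold>\<not>\<psi> \<^bold>\<Rightarrow> \<psi>) \<^bold>\<Rightarrow> \<psi>) \<^bold>\<Rightarrow> (?i \<^bold>\<Rightarrow> \<psi>)) \<^bold>\<Rightarrow> (?i \<^bold>\<Rightarrow> \<psi>))"
    using assms by (intro Th_clavius_elim) auto
  ultimately have "Th (\<^bold>\<not>?i \<^bold>\<Rightarrow> (?i \<^bold>\<Rightarrow> \<psi>))"
    using Th_trans by blast
  then have "Th (((?i \<^bold>\<Rightarrow> \<psi>) \<^bold>\<Rightarrow> ?i) \<^bold>\<Rightarrow> (\<^bold>\<not>?i \<^bold>\<Rightarrow> ?i))"
    using i Th_suffix by blast
  then have "Th (((?i \<^bold>\<Rightarrow> \<psi>) \<^bold>\<Rightarrow> ?i) \<^bold>\<Rightarrow> ?i)"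
    using i Th_clavius Th_trans by blast
  moreover have "Th ((\<phi> \<^bold>\<Rightarrow> ?i) \<^bold>\<Rightarrow> ((?i \<^bold>\<Rightarrow> \<psi>) \<^bold>\<Rightarrow> ?i))"
    using assms by (intro Th_syllogism) auto
  ultimately show ?thesis
    using Th_trans by blast
qed

text \<open>Everything reduces to the assertion law that \<open>\<psi>\<close> implies
  (\<open>?i\<close> implies \<open>\<xi>\<close>): weakening, then syllogism, then contraction of
  the repeated \<open>?i\<close>.\<close>

lemma Th_exchange:
  assumes "\<phi> \<in> Forms n" "\<psi> \<in> Forms n" "\<xi> \<in> Forms n"
  shows "Th ((\<phi> \<^bold>\<Rightarrow> (\<psi> \<^bold>\<Rightarrow> \<xi>)) \<^bold>\<Rightarrow> (\<psi> \<^bold>\<Rightarrow> (\<phi> \<^bold>\<Rightarrow> \<xi>)))"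
proof -
  let ?i = "\<psi> \<^bold>\<Rightarrow> \<xi>"
  have "Th (\<psi> \<^bold>\<Rightarrow> (?i \<^bold>\<Rightarrow> \<psi>))" "Th ((?i \<^bold>\<Rightarrow> \<psi>) \<^bold>\<Rightarrow> (?i \<^bold>\<Rightarrow> (?i \<^bold>\<Rightarrow> \<xi>)))"
    "Th ((?i \<^bold>\<Rightarrow> (?i \<^bold>\<Rightarrow> \<xi>)) \<^bold>\<Rightarrow> (?i \<^bold>\<Rightarrow> \<xi>))"
    using assms by (auto intro!: Th_K Th_syllogism Th_contraction)
  then have "Th (\<psi> \<^bold>\<Rightarrow> (?i \<^bold>\<Rightarrow> \<xi>))"
    using Th_trans by blast
  then have "Th (((?i \<^bold>\<Rightarrow> \<xi>) \<^bold>\<Rightarrow> (\<phi> \<^bold>\<Rightarrow> \<xi>)) \<^bold>\<Rightarrow> (\<psi> \<^bold>\<Rightarrow> (\<phi> \<^bold>\<Rightarrow> \<xi>)))"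
    using assms by (intro Th_suffix) auto
  moreover have "Th ((\<phi> \<^bold>\<Rightarrow> ?i) \<^bold>\<Rightarrow> ((?i \<^bold>\<Rightarrow> \<xi>) \<^bold>\<Rightarrow> (\<phi> \<^bold>\<Rightarrow> \<xi>)))"
    using assms by (intro Th_syllogism) auto
  ultimately show ?thesis
    using Th_trans by blast
qed

lemma Th_prefix:
  "\<phi> \<in> Forms n \<Longrightarrow> \<psi> \<in> Forms n \<Longrightarrow> \<xi> \<in> Forms n \<Longrightarrow>
    Th ((\<phi> \<^bold>\<Rightarrow> \<psi>) \<^bold>\<Rightarrow> ((\<xi> \<^bold>\<Rightarrow> \<phi>) \<^bold>\<Rightarrow> (\<xi> \<^bold>\<Rightarrow> \<psi>)))"
  by (rule Th_mp[OF Th_exchange]) (auto intro!: Th_syllogism)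

lemma Th_S:
  assumes "\<phi> \<in> Forms n" "\<psi> \<in> Forms n" "\<xi> \<in> Forms n"
  shows "Th ((\<phi> \<^bold>\<Rightarrow> (\<psi> \<^bold>\<Rightarrow> \<xi>)) \<^bold>\<Rightarrow> ((\<phi> \<^bold>\<Rightarrow> \<psi>) \<^bold>\<Rightarrow> (\<phi> \<^bold>\<Rightarrow> \<xi>)))"
proof -
  have "Th ((\<phi> \<^bold>\<Rightarrow> (\<psi> \<^bold>\<Rightarrow> \<xi>)) \<^bold>\<Rightarrow> (\<psi> \<^bold>\<Rightarrow> (\<phi> \<^bold>\<Rightarrow> \<xi>)))"
    using assms by (intro Th_exchange) auto
  moreover have "Th ((\<psi> \<^bold>\<Rightarrow> (\<phi> \<^bold>\<Rightarrow> \<xi>)) \<^bold>\<Rightarrow> ((\<phi> \<^bold>\<Rightarrow> \<psi>) \<^bold>\<Rightarrow> (\<phi> \<^bold>\<Rightarrow> (\<phi> \<^bold>\<Rightarrow> \<xi>))))"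
    using assms by (intro Th_prefix) auto
  moreover have "Th (((\<phi> \<^bold>\<Rightarrow> \<psi>) \<^bold>\<Rightarrow> (\<phi> \<^bold>\<Rightarrow> (\<phi> \<^bold>\<Rightarrow> \<xi>))) \<^bold>\<Rightarrow> ((\<phi> \<^bold>\<Rightarrow> \<psi>) \<^bold>\<Rightarrow> (\<phi> \<^bold>\<Rightarrow> \<xi>)))"
    using assms by (intro Th_mp[OF Th_prefix] Th_contraction) auto
  ultimately show ?thesis
    using Th_trans by blast
qed

lemma Th_contrapos:
  "\<phi> \<in> Forms n \<Longrightarrow> \<psi> \<in> Forms n \<Longrightarrow> Th ((\<^bold>\<not>\<phi> \<^bold>\<Rightarrow> \<^bold>\<not>\<psi>) \<^bold>\<Rightarrow> (\<psi> \<^bold>\<Rightarrow> \<phi>))"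
  by (intro Th_trans[OF Th_contrapos_suffix[of "\<^bold>\<not>\<phi>" \<psi> \<phi> \<phi>] Th_clavius_elim]) auto

end

section \<open>Propositional logic and quantifiers\<close>

text \<open>Quantified formulas and equations count as propositional atoms, so tautologies are
  judged without looking inside them.\<close>

primrec tv :: "(fm \<Rightarrow> bool) \<Rightarrow> fm \<Rightarrow> bool" where
  "tv v (Atom x A y) = v (Atom x A y)"
| "tv v (A \<doteq> B) = v (A \<doteq> B)"
| "tv v (\<phi> \<^bold>\<Rightarrow> \<psi>) = (tv v \<phi> \<longrightarrow> tv v \<psi>)"
| "tv v (\<^bold>\<not>\<phi>) = (\<not> tv v \<phi>)"
| "tv v (Forall x \<phi>) = v (Forall x \<phi>)"

primrec primes :: "fm \<Rightarrow> fm list" where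
  "primes (Atom x A y) = [Atom x A y]"
| "primes (A \<doteq> B) = [A \<doteq> B]"
| "primes (\<phi> \<^bold>\<Rightarrow> \<psi>) = primes \<phi> @ primes \<psi>"
| "primes (\<^bold>\<not>\<phi>) = primes \<phi>"
| "primes (Forall x \<phi>) = [Forall x \<phi>]"

lemma primes_Forms: "\<phi> \<in> Forms n \<Longrightarrow> set (primes \<phi>) \<subseteq> Forms n"
  by (induction \<phi>) auto

context first_order_system
begin

lemma Th_explosion': "\<phi> \<in> Forms n \<Longrightarrow> \<psi> \<in> Forms n \<Longrightarrow> Th (\<^bold>\<not>\<phi> \<^bold>\<Rightarrow> (\<phi> \<^bold>\<Rightarrow> \<psi>))"
  by (rule Th_mp[OF Th_exchange Th_explosion]) auto

lemma Th_not_not_elim: "\<phi> \<in> Forms n \<Longrightarrow> Th (\<^bold>\<not>(\<^bold>\<not>\<phi>) \<^bold>\<Rightarrow> \<phi>)"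
  by (rule Th_trans[OF Th_explosion' Th_clavius]) auto

lemma Th_not_not_intro: "\<phi> \<in> Forms n \<Longrightarrow> Th (\<phi> \<^bold>\<Rightarrow> \<^bold>\<not>(\<^bold>\<not>\<phi>))"
  by (rule Th_mp[OF Th_contrapos Th_not_not_elim]) auto

lemma Th_contrapos':
  assumes "\<phi> \<in> Forms n" "\<psi> \<in> Forms n"
  shows "Th ((\<phi> \<^bold>\<Rightarrow> \<psi>) \<^bold>\<Rightarrow> (\<^bold>\<not>\<psi> \<^bold>\<Rightarrow> \<^bold>\<not>\<phi>))"
proof -
  have "Th ((\<phi> \<^bold>\<Rightarrow> \<psi>) \<^bold>\<Rightarrow> (\<^bold>\<not>(\<^bold>\<not>\<phi>) \<^bold>\<Rightarrow> \<psi>))"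
    using assms Th_suffix Th_not_not_elim by blast
  moreover have "Th ((\<^bold>\<not>(\<^bold>\<not>\<phi>) \<^bold>\<Rightarrow> \<psi>) \<^bold>\<Rightarrow> (\<^bold>\<not>(\<^bold>\<not>\<phi>) \<^bold>\<Rightarrow> \<^bold>\<not>(\<^bold>\<not>\<psi>)))"
    by (rule Th_mp[OF Th_prefix Th_not_not_intro]) (use assms in auto)
  moreover have "Th ((\<^bold>\<not>(\<^bold>\<not>\<phi>) \<^bold>\<Rightarrow> \<^bold>\<not>(\<^bold>\<not>\<psi>)) \<^bold>\<Rightarrow> (\<^bold>\<not>\<psi> \<^bold>\<Rightarrow> \<^bold>\<not>\<phi>))"
    using assms by (simp add: Th_contrapos)
  ultimately show ?thesis
    using Th_trans by blast
qed

lemma Th_not_imp: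
  assumes "\<phi> \<in> Forms n" "\<psi> \<in> Forms n"
  shows "Th (\<phi> \<^bold>\<Rightarrow> (\<^bold>\<not>\<psi> \<^bold>\<Rightarrow> \<^bold>\<not>(\<phi> \<^bold>\<Rightarrow> \<psi>)))"
proof -
  have "Th ((\<phi> \<^bold>\<Rightarrow> \<psi>) \<^bold>\<Rightarrow> (\<phi> \<^bold>\<Rightarrow> \<psi>))"
    using assms Th_trans[OF Th_not_not_intro Th_not_not_elim, of "\<phi> \<^bold>\<Rightarrow> \<psi>"] by simp
  then have "Th (\<phi> \<^bold>\<Rightarrow> ((\<phi> \<^bold>\<Rightarrow> \<psi>) \<^bold>\<Rightarrow> \<psi>))"
    by (rule Th_mp[OF Th_exchange, rotated -1]) (use assms in auto)
  moreover have "Th (((\<phi> \<^bold>\<Rightarrow> \<psi>) \<^bold>\<Rightarrow> \<psi>) \<^bold>\<Rightarrow> (\<^bold>\<not>\<psi> \<^bold>\<Rightarrow> \<^bold>\<not>(\<phi> \<^bold>\<Rightarrow> \<psi>)))"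
    using assms by (simp add: Th_contrapos')
  ultimately show ?thesis
    using Th_trans by blast
qed

lemma Th_cases:
  assumes "Th (\<phi> \<^bold>\<Rightarrow> \<psi>)" "Th (\<^bold>\<not>\<phi> \<^bold>\<Rightarrow> \<psi>)"
  shows "Th \<psi>"
proof -
  have F: "\<phi> \<in> Forms n" "\<psi> \<in> Forms n"
    using Th_Forms[OF assms(1)] by auto
  have "Th (\<^bold>\<not>\<psi> \<^bold>\<Rightarrow> \<^bold>\<not>\<phi>)"
    using Th_mp[OF Th_contrapos'] F assms(1) by blast
  then show ?thesis
    using Th_trans assms(2) Th_mp[OF Th_clavius] F(2) by blast
qed

section \<open>Completeness for propositional tautologies\<close>

definition Ent :: "fm list \<Rightarrow> fm \<Rightarrow> bool" where
  "Ent gs \<phi> \<longleftrightarrow> Th (foldr Imp gs \<phi>)"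

lemma foldr_Imp_Forms [simp]:
  "foldr Imp gs \<phi> \<in> Forms n \<longleftrightarrow> set gs \<subseteq> Forms n \<and> \<phi> \<in> Forms n"
  by (induction gs) auto

lemma Ent_mp:
  assumes "Ent gs (\<phi> \<^bold>\<Rightarrow> \<psi>)" "Ent gs \<phi>"
  shows "Ent gs \<psi>"
proof -
  have "Th (foldr Imp gs (\<phi> \<^bold>\<Rightarrow> \<psi>) \<^bold>\<Rightarrow> (foldr Imp gs \<phi> \<^bold>\<Rightarrow> foldr Imp gs \<psi>))"
    if "set gs \<subseteq> Forms n" "\<phi> \<in> Forms n" "\<psi> \<in> Forms n"
    using that
  proof (induction gs)
    case Nil
    then show ?case
      using Th_trans[OF Th_not_not_intro Th_not_not_elim, of "\<phi> \<^bold>\<Rightarrow> \<psi>"] by simp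
  next
    case (Cons g gs)
    let ?a = "foldr Imp gs (\<phi> \<^bold>\<Rightarrow> \<psi>)" and ?b = "foldr Imp gs \<phi>" and ?c = "foldr Imp gs \<psi>"
    have "Th ((g \<^bold>\<Rightarrow> ?a) \<^bold>\<Rightarrow> (g \<^bold>\<Rightarrow> (?b \<^bold>\<Rightarrow> ?c)))"
      by (rule Th_mp[OF Th_prefix Cons.IH]) (use Cons.prems in auto)
    moreover have "Th ((g \<^bold>\<Rightarrow> (?b \<^bold>\<Rightarrow> ?c)) \<^bold>\<Rightarrow> ((g \<^bold>\<Rightarrow> ?b) \<^bold>\<Rightarrow> (g \<^bold>\<Rightarrow> ?c)))"
      using Cons.prems by (intro Th_S) auto
    ultimately show ?case
      using Th_trans by auto
  qed
  moreover have "set gs \<subseteq> Forms n" "\<phi> \<in> Forms n" "\<psi> \<in> Forms n"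
    using assms Th_Forms unfolding Ent_def by force+
  ultimately show ?thesis
    using assms Th_mp unfolding Ent_def by blast
qed

lemma Ent_Th: "Th \<phi> \<Longrightarrow> set gs \<subseteq> Forms n \<Longrightarrow> Ent gs \<phi>"
proof (induction gs)
  case (Cons g gs)
  then have "Th (foldr Imp gs \<phi>)"
    by (simp add: Ent_def)
  then have "Th (g \<^bold>\<Rightarrow> foldr Imp gs \<phi>)"
    using Th_mp[OF Th_K] Th_Forms Cons.prems(2) by auto
  then show ?case
    by (simp add: Ent_def)
qed (simp add: Ent_def)

lemma Ent_member: "\<phi> \<in> set gs \<Longrightarrow> set gs \<subseteq> Forms n \<Longrightarrow> Ent gs \<phi>"
proof (induction gs)
  case (Cons g gs)
  have K: "Th (\<phi> \<^bold>\<Rightarrow> foldr Imp hs \<phi>)" if "set hs \<subseteq> Forms n" "\<phi> \<in> Forms n" for hs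
    using that
  proof (induction hs)
    case Nil
    then show ?case
      using Th_trans[OF Th_not_not_intro Th_not_not_elim] by simp
  next
    case (Cons h hs)
    then have "Th (\<phi> \<^bold>\<Rightarrow> foldr Imp hs \<phi>)" "Th (foldr Imp hs \<phi> \<^bold>\<Rightarrow> (h \<^bold>\<Rightarrow> foldr Imp hs \<phi>))"
      by (auto intro!: Th_K)
    then show ?case
      using Th_trans by auto
  qed
  show ?case
  proof (cases "\<phi> = g")
    case True
    then show ?thesis
      using K[of gs] Cons.prems by (simp add: Ent_def)
  next
    case False
    then have "Th (foldr Imp gs \<phi>)"
      using Cons by (simp add: Ent_def)
    then have "Th (g \<^bold>\<Rightarrow> foldr Imp gs \<phi>)"
      using Th_mp[OF Th_K] Th_Forms Cons.prems(2) by auto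
    then show ?thesis
      by (simp add: Ent_def)
  qed
qed simp

abbreviation literal :: "(fm \<Rightarrow> bool) \<Rightarrow> fm \<Rightarrow> fm" where
  "literal v p \<equiv> if v p then p else \<^bold>\<not>p"

text \<open>The inductive half of Kalmar's completeness proof. An implication needs three theorems:
  from a false antecedent, from a true consequent, and from a true antecedent with a false
  consequent.\<close>

lemma Ent_kalmar:
  assumes "\<phi> \<in> Forms n" "set gs \<subseteq> Forms n" "\<forall>p\<in>set (primes \<phi>). literal v p \<in> set gs"
  shows "Ent gs (if tv v \<phi> then \<phi> else \<^bold>\<not>\<phi>)"
  using assms
proof (induction \<phi>)
  case (Imp \<phi> \<psi>)
  then have F: "\<phi> \<in> Forms n" "\<psi> \<in> Forms n"
    by auto
  have IH: "Ent gs (if tv v \<phi> then \<phi> else \<^bold>\<not>\<phi>)" "Ent gs (if tv v \<psi> then \<psi> else \<^bold>\<not>\<psi>)"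
    using Imp by auto
  have thms: "Ent gs (\<^bold>\<not>\<phi> \<^bold>\<Rightarrow> (\<phi> \<^bold>\<Rightarrow> \<psi>))" "Ent gs (\<psi> \<^bold>\<Rightarrow> (\<phi> \<^bold>\<Rightarrow> \<psi>))"
    "Ent gs (\<phi> \<^bold>\<Rightarrow> (\<^bold>\<not>\<psi> \<^bold>\<Rightarrow> \<^bold>\<not>(\<phi> \<^bold>\<Rightarrow> \<psi>)))"
    using F Imp.prems(2) by (auto intro: Ent_Th Th_explosion' Th_K Th_not_imp)
  show ?case
  proof (cases "tv v \<phi>"; cases "tv v \<psi>")
    assume "tv v \<phi>" "tv v \<psi>"
    then show ?thesis using IH Ent_mp[OF thms(2)] by simp
  next
    assume "tv v \<phi>" "\<not> tv v \<psi>"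
    then show ?thesis using IH Ent_mp[OF Ent_mp[OF thms(3)]] by simp
  next
    assume "\<not> tv v \<phi>" "tv v \<psi>"
    then show ?thesis using IH Ent_mp[OF thms(2)] by simp
  next
    assume "\<not> tv v \<phi>" "\<not> tv v \<psi>"
    then show ?thesis using IH Ent_mp[OF thms(1)] by simp
  qed
next
  case (FNot \<phi>)
  then have F: "\<phi> \<in> Forms n"
    by auto
  have IH: "Ent gs (if tv v \<phi> then \<phi> else \<^bold>\<not>\<phi>)"
    using FNot by auto
  have "Ent gs (\<phi> \<^bold>\<Rightarrow> \<^bold>\<not>(\<^bold>\<not>\<phi>))"
    using F FNot.prems(2) by (auto intro: Ent_Th Th_not_not_intro)
  then show ?case
    using IH Ent_mp by (cases "tv v \<phi>") auto
qed (auto intro: Ent_member)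

text \<open>The other half of Kalmar's argument: literals are removed one by one, by cases on the
  sign of the head. Distinctness ensures that changing the valuation at the head leaves the
  remaining literals alone.\<close>

lemma Ent_literals_elim:
  assumes "\<And>v. Ent (map (literal v) ps) \<phi>" "distinct ps"
  shows "Th \<phi>"
  using assms
proof (induction ps)
  case Nil
  then show ?case
    by (simp add: Ent_def)
next
  case (Cons p ps)
  show ?case
  proof (rule Cons.IH)
    fix v
    have eq: "map (literal (v(p := b))) ps = map (literal v) ps" for b
      using Cons.prems(2) by auto
    have "Ent (p # map (literal v) ps) \<phi>" "Ent ((\<^bold>\<not>p) # map (literal v) ps) \<phi>"
      using Cons.prems(1)[of "v(p := True)"] Cons.prems(1)[of "v(p := False)"]
      unfolding list.map eq by simp_all
    then show "Ent (map (literal v) ps) \<phi>"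
      unfolding Ent_def using Th_cases by simp
  qed (use Cons.prems in simp)
qed

text \<open>From here on propositional steps of the object logic are delegated to the metalogic: the
  hypothesis on valuations is a goal about booleans.\<close>

lemma Th_tautology:
  assumes "\<And>v. tv v \<phi>" "\<phi> \<in> Forms n"
  shows "Th \<phi>"
proof (rule Ent_literals_elim)
  fix v
  have "set (map (literal v) (remdups (primes \<phi>))) \<subseteq> Forms n"
    using primes_Forms[OF assms(2)] by auto
  then show "Ent (map (literal v) (remdups (primes \<phi>))) \<phi>"
    using Ent_kalmar[OF assms(2), of _ v] assms(1) by simp
qed simp

lemma Th_taut1:
  assumes "Th \<phi>" "\<And>v. tv v \<phi> \<Longrightarrow> tv v \<xi>" "\<xi> \<in> Forms n"
  shows "Th \<xi>"
  by (rule Th_mp[OF Th_tautology assms(1)]) (use assms Th_Forms[OF assms(1)] in auto)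

lemma Th_taut2:
  assumes "Th \<phi>" "Th \<psi>" "\<And>v. tv v \<phi> \<Longrightarrow> tv v \<psi> \<Longrightarrow> tv v \<xi>" "\<xi> \<in> Forms n"
  shows "Th \<xi>"
  by (rule Th_mp[OF Th_taut1[OF assms(1)] assms(2)])
    (use assms Th_Forms[OF assms(2)] in auto)

lemma Th_taut3:
  assumes "Th \<phi>" "Th \<psi>" "Th \<chi>" "\<And>v. tv v \<phi> \<Longrightarrow> tv v \<psi> \<Longrightarrow> tv v \<chi> \<Longrightarrow> tv v \<xi>" "\<xi> \<in> Forms n"
  shows "Th \<xi>"
  by (rule Th_mp[OF Th_taut2[OF assms(1,2)] assms(3)])
    (use assms Th_Forms[OF assms(3)] in auto)

section \<open>Quantifier rules\<close>

lemma Th_all_mono: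
  assumes "Th (\<phi> \<^bold>\<Rightarrow> \<psi>)" "x \<in> Vars n"
  shows "Th (Forall x \<phi> \<^bold>\<Rightarrow> Forall x \<psi>)"
proof -
  have "Th (Forall x (\<phi> \<^bold>\<Rightarrow> \<psi>) \<^bold>\<Rightarrow> (Forall x \<phi> \<^bold>\<Rightarrow> Forall x \<psi>))"
    using Th_Forms[OF assms(1)] assms(2) by (intro Th_axiom axioms.all_distrib) auto
  then show ?thesis
    using Th_mp Th_gen assms by blast
qed

lemma Th_ex_left:
  assumes "Th (\<phi> \<^bold>\<Rightarrow> \<psi>)" "x \<in> Vars n" "x \<notin> free_vars \<psi>"
  shows "Th (Exists x \<phi> \<^bold>\<Rightarrow> \<psi>)"
proof -
  have F: "\<phi> \<in> Forms n" "\<psi> \<in> Forms n"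
    using Th_Forms[OF assms(1)] by auto
  have "Th (\<^bold>\<not>\<psi> \<^bold>\<Rightarrow> \<^bold>\<not>\<phi>)"
    by (rule Th_taut1[OF assms(1)]) (use F in auto)
  then have "Th (Forall x (\<^bold>\<not>\<psi>) \<^bold>\<Rightarrow> Forall x (\<^bold>\<not>\<phi>))"
    using Th_all_mono assms(2) by blast
  moreover have "Th (\<^bold>\<not>\<psi> \<^bold>\<Rightarrow> Forall x (\<^bold>\<not>\<psi>))"
    using F assms by (intro Th_axiom axioms.all_vacuous) auto
  ultimately show ?thesis
    by (rule Th_taut2) (use F assms in auto)
qed

lemma Th_ex_right:
  assumes "\<phi> \<in> Forms n" "x \<in> Vars n"
  shows "Th (\<phi> \<^bold>\<Rightarrow> Exists x \<phi>)"
proof -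
  have "Th (Forall x (\<^bold>\<not>\<phi>) \<^bold>\<Rightarrow> \<^bold>\<not>\<phi>)"
    using assms by (intro Th_axiom axioms.all_elim) auto
  then show ?thesis
    by (rule Th_taut1) (use assms in auto)
qed

end

section \<open>Relation algebra in four variables\<close>

lemma free_vars_rename:
  assumes "inj f"
  shows "free_vars (rename f \<phi>) = f ` free_vars \<phi>"
  by (induction \<phi>) (use assms in \<open>auto simp: inj_image_mem_iff image_set_diff dest: injD\<close>)

lemma free_vars_interchange:
  "v \<in> free_vars (interchange x y \<phi>) \<longleftrightarrow> transpose x y v \<in> free_vars \<phi>"
  by (simp add: interchange_def free_vars_rename image_iff)
    (metis transpose_involutory)

lemma interchange_commute: "interchange x y = interchange y x"
  by (simp add: interchange_def transpose_commute)

lemma interchange_same: "interchange x x \<phi> = \<phi>"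
  by (simp add: interchange_def form.map_id)

lemma interchange_Forms:
  assumes "\<phi> \<in> Forms n" "x \<in> Vars n" "y \<in> Vars n"
  shows "interchange x y \<phi> \<in> Forms n"
  using assms by (auto simp: Forms_def interchange_def form.set_map transpose_def)

lemma interchange_via:
  assumes "z \<noteq> x" "z \<noteq> y" "x \<noteq> y"
  shows "interchange z y (interchange y x (interchange x z \<phi>)) = interchange x y \<phi>"
proof -
  have "transpose z y \<circ> (transpose y x \<circ> transpose x z) = transpose x y"
    using assms by (auto simp: fun_eq_iff transpose_def)
  then show ?thesis
    by (simp add: interchange_def form.map_comp)
qed

context first_order_system
begin

text \<open>The finite Leibniz axiom interchanges x and y under the assumption that they are equal.
  As y is not free before, x is not free afterwards, so the assumption can be quantified
  existentially over x and discharged by \<open>ex_equal\<close>. This replaces a substitution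
  rule.\<close>

lemma Th_interchange_fresh:
  assumes "n < \<infinity>" "Th \<phi>" "x \<in> Vars n" "y \<in> Vars n" "y \<notin> free_vars \<phi>"
  shows "Th (interchange x y \<phi>)"
proof (cases "x = y")
  case False
  let ?\<psi> = "interchange x y \<phi>"
  have F: "\<phi> \<in> Forms n" "?\<psi> \<in> Forms n"
    using Th_Forms[OF assms(2)] interchange_Forms assms by auto
  have "Th (Atom x 1\<^sub>p y \<^bold>\<Rightarrow> (\<phi> \<^bold>\<Rightarrow> ?\<psi>))"
    using assms F by (intro Th_axiom axioms.leibniz_finite) auto
  then have "Th (Atom x 1\<^sub>p y \<^bold>\<Rightarrow> ?\<psi>)"
    by (rule Th_taut2[OF assms(2)]) (use F assms in auto)
  moreover have "x \<notin> free_vars ?\<psi>"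
    using assms(5) by (auto simp: free_vars_interchange)
  ultimately have "Th (Exists x (Atom x 1\<^sub>p y) \<^bold>\<Rightarrow> ?\<psi>)"
    using Th_ex_left assms by blast
  moreover have "Th (Exists x (Atom x 1\<^sub>p y))"
    using assms False by (intro Th_axiom axioms.ex_equal) auto
  ultimately show ?thesis
    using Th_mp by blast
qed (use assms interchange_same in simp)

text \<open>Two free variables are swapped like two registers, through the buffer z: in each of the
  three interchanges one of the variables is not free.\<close>

lemma Th_interchange:
  assumes "n < \<infinity>" "Th \<phi>" "x \<in> Vars n" "y \<in> Vars n" "z \<in> Vars n" "z \<notin> free_vars \<phi>"
  shows "Th (interchange x y \<phi>)"
proof (cases "x = y \<or> x \<notin> free_vars \<phi> \<or> y \<notin> free_vars \<phi>")
  case True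
  then show ?thesis
    using Th_interchange_fresh[OF assms(1,2)] assms interchange_same interchange_commute by metis
next
  case False
  then have ne: "z \<noteq> x" "z \<noteq> y" "x \<noteq> y"
    using assms by auto
  have "Th (interchange x z \<phi>)"
    using Th_interchange_fresh assms by blast
  then have "Th (interchange y x (interchange x z \<phi>))"
    using ne assms by (intro Th_interchange_fresh)
      (auto simp: free_vars_interchange)
  then have "Th (interchange z y (interchange y x (interchange x z \<phi>)))"
    using ne assms by (intro Th_interchange_fresh)
      (auto simp: free_vars_interchange)
  then show ?thesis
    using interchange_via ne by metis
qed

end

lemma Vars_4: "Vars 4 = {0, 1, 2, 3}"
proof -
  have "enat i < 4 \<longleftrightarrow> i < 4" for i
    using enat_ord_simps(2)[of i 4] by (simp only: numeral_eq_enat)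
  moreover have "i < 4 \<longleftrightarrow> i = 0 \<or> i = 1 \<or> i = 2 \<or> i = 3" for i :: nat
    by arith
  ultimately show ?thesis
    unfolding Vars_def by blast
qed

locale four_variables = first_order_system 4 \<Psi> for \<Psi>
begin

text \<open>With at most two free variables, one of the four is always spare, and three interchanges
  reach any three distinct variables from v0, v1, v2. Interchanges never identify variables, so all
  instances have distinct arguments.\<close>

lemma Th_instance:
  assumes rename: "\<And>p q a b c. interchange p q (F a b c) = F (transpose p q a) (transpose p q b) (transpose p q c)"
    and free: "\<And>a b c. free_vars (F a b c) \<subseteq> {a, b}"
    and "Th (F 0 1 2)" "distinct [x, y, z]" "{x, y, z} \<subseteq> Vars 4"
  shows "Th (F x y z)"
proof -
  have swap: "Th (F (transpose p q a) (transpose p q b) (transpose p q c))"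
    if "Th (F a b c)" "p \<in> Vars 4" "q \<in> Vars 4" for p q a b c
  proof -
    have "card (free_vars (F a b c)) \<le> card {a, b}"
      by (intro card_mono free) simp
    also have "\<dots> \<le> 2"
      by (simp add: card_insert_if)
    finally have "card (free_vars (F a b c)) \<le> 2" .
    moreover have "card (Vars 4) = 4"
      by (simp add: Vars_4)
    ultimately have "\<not> Vars 4 \<subseteq> free_vars (F a b c)"
      using card_mono[OF finite_free_vars, of "Vars 4" "F a b c"] by linarith
    then obtain r where "r \<in> Vars 4" "r \<notin> free_vars (F a b c)"
      by blast
    then show ?thesis
      using Th_interchange[OF _ that(1), of p q r] that rename by simp
  qed
  \<comment> \<open>\<open>b\<close> is the place of v1 after the first interchange,
    \<open>c\<close> the place of v2 after the second.\<close>
  define b c where "b = transpose 0 x 1" and "c = transpose b y (transpose 0 x 2)"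
  have V: "(0 :: nat) \<in> Vars 4" "(1 :: nat) \<in> Vars 4" "(2 :: nat) \<in> Vars 4"
    by (auto simp: Vars_4)
  have "Th (F x b (transpose 0 x 2))"
    using swap[OF assms(3), of 0 x] assms(5) V by (simp add: b_def)
  moreover have b: "b \<in> Vars 4" "b \<noteq> x"
    using assms(5) V by (auto simp: b_def transpose_def)
  ultimately have "Th (F x y c)"
    using swap[of x b "transpose 0 x 2" b y] assms(4,5) by (simp add: c_def)
  moreover have "c \<in> Vars 4" "c \<noteq> x" "c \<noteq> y"
    using assms(4,5) V b by (auto simp: c_def b_def transpose_def split: if_splits)
  ultimately show ?thesis
    using swap[of x y c c z] assms(4,5) by simp
qed

text \<open>An inclusion with two free variables, as \<open>Th_instance\<close> demands;
  \<open>provable_Leq\<close> turns it into the provable inequality of predicates.\<close>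

definition LE :: "predicate \<Rightarrow> predicate \<Rightarrow> bool" where
  "LE A B \<longleftrightarrow> Th (Atom 0 A 1 \<^bold>\<Rightarrow> Atom 0 B 1)"

lemma Atom_Forms4 [simp]: "Atom x A y \<in> Forms 4 \<longleftrightarrow> x < 4 \<and> y < 4"
  by (auto simp: Vars_4)

lemma Vars4 [simp]: "x \<in> Vars 4 \<longleftrightarrow> x < 4"
  by (auto simp: Vars_4)

lemma fresh_variable:
  assumes "x < 4" "y < (4 :: nat)"
  obtains z :: nat where "z < 4" "z \<noteq> x" "z \<noteq> y"
proof -
  have "\<exists>z\<in>{0, 1, 2 :: nat}. z \<noteq> x \<and> z \<noteq> y"
    by auto
  then obtain z where "z \<in> {0, 1, 2 :: nat}" "z \<noteq> x" "z \<noteq> y"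
    by blast
  then show ?thesis
    by (intro that[of z]) auto
qed

lemma LE_instance:
  assumes "LE A B" "x \<noteq> y" "x < 4" "y < 4"
  shows "Th (Atom x A y \<^bold>\<Rightarrow> Atom x B y)"
proof -
  obtain z where "z < 4" "z \<noteq> x" "z \<noteq> y"
    using fresh_variable assms by blast
  then show ?thesis
    using assms by (intro Th_instance[of "\<lambda>x y z. Atom x A y \<^bold>\<Rightarrow> Atom x B y" x y z])
      (auto simp: interchange_def LE_def)
qed

lemma Th_sum:
  assumes "x \<noteq> y" "x < 4" "y < 4"
  shows "Th (Atom x (A \<^bold>+ B) y \<^bold>\<Leftrightarrow> Atom x A y \<^bold>\<or>\<^sub>f Atom x B y)"
proof -
  obtain z where "z < 4" "z \<noteq> x" "z \<noteq> y"
    using fresh_variable assms by blast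
  moreover have "Th (Atom 0 (A \<^bold>+ B) 1 \<^bold>\<Leftrightarrow> Atom 0 A 1 \<^bold>\<or>\<^sub>f Atom 0 B 1)"
    by (intro Th_axiom axioms.sum) auto
  ultimately show ?thesis
    using assms by (intro Th_instance[of "\<lambda>x y z. Atom x (A \<^bold>+ B) y \<^bold>\<Leftrightarrow> Atom x A y \<^bold>\<or>\<^sub>f Atom x B y" x y z])
      (auto simp: interchange_def)
qed

lemma Th_compl:
  assumes "x \<noteq> y" "x < 4" "y < 4"
  shows "Th (Atom x (\<^bold>-A) y \<^bold>\<Leftrightarrow> \<^bold>\<not>(Atom x A y))"
proof -
  obtain z where "z < 4" "z \<noteq> x" "z \<noteq> y"
    using fresh_variable assms by blast
  moreover have "Th (Atom 0 (\<^bold>-A) 1 \<^bold>\<Leftrightarrow> \<^bold>\<not>(Atom 0 A 1))"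
    by (intro Th_axiom axioms.compl) auto
  ultimately show ?thesis
    using assms by (intro Th_instance[of "\<lambda>x y z. Atom x (\<^bold>-A) y \<^bold>\<Leftrightarrow> \<^bold>\<not>(Atom x A y)" x y z])
      (auto simp: interchange_def)
qed

lemma Th_conv:
  assumes "x \<noteq> y" "x < 4" "y < 4"
  shows "Th (Atom x (A\<^sup>\<smile>) y \<^bold>\<Leftrightarrow> Atom y A x)"
proof -
  obtain z where "z < 4" "z \<noteq> x" "z \<noteq> y"
    using fresh_variable assms by blast
  moreover have "Th (Atom 0 (A\<^sup>\<smile>) 1 \<^bold>\<Leftrightarrow> Atom 1 A 0)"
    by (intro Th_axiom axioms.conv) auto
  ultimately show ?thesis
    using assms by (intro Th_instance[of "\<lambda>x y z. Atom x (A\<^sup>\<smile>) y \<^bold>\<Leftrightarrow> Atom y A x" x y z])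
      (auto simp: interchange_def)
qed

lemma Th_relprod:
  assumes "distinct [x, y, z]" "x < 4" "y < 4" "z < 4"
  shows "Th (Atom x (A \<^bold>; B) y \<^bold>\<Leftrightarrow> Exists z (Atom x A z \<^bold>\<and>\<^sub>f Atom z B y))"
proof -
  have "Th (Atom 0 (A \<^bold>; B) 1 \<^bold>\<Leftrightarrow> Exists 2 (Atom 0 A 2 \<^bold>\<and>\<^sub>f Atom 2 B 1))"
    by (intro Th_axiom axioms.relprod) auto
  then show ?thesis
    using assms by (intro Th_instance[of
        "\<lambda>x y z. Atom x (A \<^bold>; B) y \<^bold>\<Leftrightarrow> Exists z (Atom x A z \<^bold>\<and>\<^sub>f Atom z B y)" x y z])
      (auto simp: interchange_def)
qed

lemma Th_relprod_intro:
  assumes "distinct [x, y, z]" "x < 4" "y < 4" "z < 4"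
  shows "Th (Atom x A z \<^bold>\<Rightarrow> Atom z B y \<^bold>\<Rightarrow> Atom x (A \<^bold>; B) y)"
proof -
  have "Th (Atom x A z \<^bold>\<and>\<^sub>f Atom z B y \<^bold>\<Rightarrow> Exists z (Atom x A z \<^bold>\<and>\<^sub>f Atom z B y))"
    using assms by (intro Th_ex_right) auto
  then show ?thesis
    by (rule Th_taut2[OF Th_relprod[OF assms, of A B]]) (use assms in auto)
qed

lemma Th_relprod_elim:
  assumes "Th (Atom x A z \<^bold>\<Rightarrow> Atom z B y \<^bold>\<Rightarrow> \<phi>)" "distinct [x, y, z]" "z \<notin> free_vars \<phi>"
  shows "Th (Atom x (A \<^bold>; B) y \<^bold>\<Rightarrow> \<phi>)"
proof -
  have F: "x < 4" "y < 4" "z < 4" "\<phi> \<in> Forms 4"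
    using Th_Forms[OF assms(1)] by auto
  have "Th (Atom x A z \<^bold>\<and>\<^sub>f Atom z B y \<^bold>\<Rightarrow> \<phi>)"
    by (rule Th_taut1[OF assms(1)]) (use F in auto)
  then have "Th (Exists z (Atom x A z \<^bold>\<and>\<^sub>f Atom z B y) \<^bold>\<Rightarrow> \<phi>)"
    using F assms by (intro Th_ex_left) auto
  then show ?thesis
    by (rule Th_taut2[OF Th_relprod[OF assms(2) F(1-3), of A B]]) (use F in auto)
qed

section \<open>Calculus of inclusions and residuation\<close>

lemma LE_refl: "LE A A"
  unfolding LE_def by (rule Th_tautology) auto

lemma LE_trans: "LE A B \<Longrightarrow> LE B C \<Longrightarrow> LE A C"
  unfolding LE_def using Th_trans by blast

lemma LE_relprod_mono:
  assumes "LE A A'" "LE B B'"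
  shows "LE (A \<^bold>; B) (A' \<^bold>; B')"
proof -
  have "Th (Atom 0 A 2 \<^bold>\<Rightarrow> Atom 2 B 1 \<^bold>\<Rightarrow> Atom 0 (A' \<^bold>; B') 1)"
    by (rule Th_taut3[OF LE_instance[OF assms(1), of 0 2] LE_instance[OF assms(2), of 2 1]
          Th_relprod_intro[of 0 1 2 A' B']]) auto
  then show ?thesis
    unfolding LE_def by (rule Th_relprod_elim) auto
qed

text \<open>Associativity is what the fourth variable is for: v0 and v1 are the ends, v2 the outer
  and v3 the inner intermediate point. The inner existential is removed first, and meanwhile the
  premise about \<open>A\<close> waits in the conclusion.\<close>

lemma LE_assoc1: "LE (A \<^bold>; (B \<^bold>; C)) ((A \<^bold>; B) \<^bold>; C)"
proof -
  have "Th (Atom 2 B 3 \<^bold>\<Rightarrow> Atom 3 C 1 \<^bold>\<Rightarrow> (Atom 0 A 2 \<^bold>\<Rightarrow> Atom 0 ((A \<^bold>; B) \<^bold>; C) 1))"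
    by (rule Th_taut2[OF Th_relprod_intro[of 0 3 2 A B] Th_relprod_intro[of 0 1 3 "A \<^bold>; B" C]]) auto
  then have "Th (Atom 2 (B \<^bold>; C) 1 \<^bold>\<Rightarrow> (Atom 0 A 2 \<^bold>\<Rightarrow> Atom 0 ((A \<^bold>; B) \<^bold>; C) 1))"
    by (rule Th_relprod_elim) auto
  then have "Th (Atom 0 A 2 \<^bold>\<Rightarrow> Atom 2 (B \<^bold>; C) 1 \<^bold>\<Rightarrow> Atom 0 ((A \<^bold>; B) \<^bold>; C) 1)"
    by (rule Th_taut1) auto
  then show ?thesis
    unfolding LE_def by (rule Th_relprod_elim) auto
qed

lemma LE_assoc2: "LE ((A \<^bold>; B) \<^bold>; C) (A \<^bold>; (B \<^bold>; C))"
proof -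
  have "Th (Atom 0 A 3 \<^bold>\<Rightarrow> Atom 3 B 2 \<^bold>\<Rightarrow> (Atom 2 C 1 \<^bold>\<Rightarrow> Atom 0 (A \<^bold>; (B \<^bold>; C)) 1))"
    by (rule Th_taut2[OF Th_relprod_intro[of 3 1 2 B C] Th_relprod_intro[of 0 1 3 A "B \<^bold>; C"]]) auto
  then have "Th (Atom 0 (A \<^bold>; B) 2 \<^bold>\<Rightarrow> (Atom 2 C 1 \<^bold>\<Rightarrow> Atom 0 (A \<^bold>; (B \<^bold>; C)) 1))"
    by (rule Th_relprod_elim) auto
  then show ?thesis
    unfolding LE_def by (rule Th_relprod_elim) auto
qed

text \<open>Residuation. A pair (v0, v1) outside the arrow has a v2 with v2 \<open>A\<close> v0 and
  not v2 \<open>B\<close> v1; if v0 \<open>X\<close> v1 held, the hypothesis at (v2, v1) would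
  contradict this.\<close>

lemma LE_arrowI:
  assumes "LE (A \<^bold>; X) B"
  shows "LE X (A \<^bold>\<rightarrow> B)"
proof -
  have "Th (Atom 2 A 0 \<^bold>\<Rightarrow> Atom 0 X 1 \<^bold>\<Rightarrow> Atom 2 B 1)"
    by (rule Th_taut2[OF Th_relprod_intro[of 2 1 0 A X] LE_instance[OF assms, of 2 1]]) auto
  then have "Th (Atom 0 (A\<^sup>\<smile>) 2 \<^bold>\<Rightarrow> Atom 2 (\<^bold>-B) 1 \<^bold>\<Rightarrow> \<^bold>\<not>(Atom 0 X 1))"
    by (rule Th_taut3[OF _ Th_compl[of 2 1 B] Th_conv[of 0 2 A]]) auto
  then have "Th (Atom 0 (A\<^sup>\<smile> \<^bold>; \<^bold>-B) 1 \<^bold>\<Rightarrow> \<^bold>\<not>(Atom 0 X 1))"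
    by (rule Th_relprod_elim) auto
  then show ?thesis
    unfolding LE_def by (rule Th_taut2[OF _ Th_compl[of 0 1 "A\<^sup>\<smile> \<^bold>; \<^bold>-B"]]) auto
qed

lemma LE_modus_ponens: "LE (A \<^bold>; (A \<^bold>\<rightarrow> B)) B"
proof -
  have "Th (Atom 2 A\<^sup>\<smile> 0 \<^bold>\<Rightarrow> Atom 2 (A \<^bold>\<rightarrow> B) 1 \<^bold>\<Rightarrow> Atom 0 B 1)"
    by (rule Th_taut3[OF Th_relprod_intro[of 2 1 0 "A\<^sup>\<smile>" "\<^bold>-B"] Th_compl[of 0 1 B]
          Th_compl[of 2 1 "A\<^sup>\<smile> \<^bold>; \<^bold>-B"]]) auto
  then have "Th (Atom 0 A 2 \<^bold>\<Rightarrow> Atom 2 (A \<^bold>\<rightarrow> B) 1 \<^bold>\<Rightarrow> Atom 0 B 1)"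
    by (rule Th_taut2[OF _ Th_conv[of 2 0 A]]) auto
  then show ?thesis
    unfolding LE_def by (rule Th_relprod_elim) auto
qed

text \<open>The interchange in the Leibniz axiom acts as a substitution of v1 for v2, since v1 does
  not occur in \<open>Atom 0 A 2\<close>.\<close>

lemma LE_right_ident: "LE (A \<^bold>; 1\<^sub>p) A"
proof -
  have "interchange 2 1 (Atom 0 A 2) = Atom 0 A 1"
    by (simp add: interchange_def)
  then have "Th (Atom 2 1\<^sub>p 1 \<^bold>\<Rightarrow> (Atom 0 A 2 \<^bold>\<Rightarrow> Atom 0 A 1))"
    using axioms.leibniz_finite[of 4 "Atom 0 A 2" 2 1] by (intro Th_axiom) auto
  then have "Th (Atom 0 A 2 \<^bold>\<Rightarrow> Atom 2 1\<^sub>p 1 \<^bold>\<Rightarrow> Atom 0 A 1)"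
    by (rule Th_taut1) auto
  then show ?thesis
    unfolding LE_def by (rule Th_relprod_elim) auto
qed

lemma LE_compl:
  assumes "LE A B"
  shows "LE (\<^bold>-B) (\<^bold>-A)"
  unfolding LE_def
  by (rule Th_taut3[OF assms[unfolded LE_def] Th_compl[of 0 1 A] Th_compl[of 0 1 B]]) auto

lemma LE_compl_compl: "LE (\<^bold>-\<^bold>-A) A" "LE A (\<^bold>-\<^bold>-A)"
  unfolding LE_def
  by (rule Th_taut2[OF Th_compl[of 0 1 A] Th_compl[of 0 1 "\<^bold>-A"]]; auto)+

lemma Th_equation:
  assumes "E = (Atom 0 A 1 \<^bold>\<Leftrightarrow> Atom 0 B 1)"
  shows "Th (A \<doteq> B \<^bold>\<Leftrightarrow> closure E)" "closure E \<in> Forms 4"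
proof -
  have "E \<in> Forms 4"
    using assms by simp
  then show F: "closure E \<in> Forms 4"
    using free_vars_Forms unfolding closure_def by (metis alls_Forms set_sorted_list_of_set finite_free_vars)
  have "closure (A \<doteq> B \<^bold>\<Leftrightarrow> closure E) = (A \<doteq> B \<^bold>\<Leftrightarrow> closure E)"
    by (intro closure_closed) simp
  then show "Th (A \<doteq> B \<^bold>\<Leftrightarrow> closure E)"
    using axioms.equation[of A B 4] assms F by (intro Th_axiom) auto
qed

lemma LE_hyp:
  assumes "A \<doteq> B \<in> \<Psi>"
  shows "LE A B" "LE B A"
proof -
  let ?E = "Atom 0 A 1 \<^bold>\<Leftrightarrow> Atom 0 B 1"
  have "Th (A \<doteq> B)"
    using assms by (intro Th_hyp) auto
  then have "Th (closure ?E)"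
    by (rule Th_taut2[OF _ Th_equation(1)[OF refl]]) (use Th_equation(2)[OF refl] in auto)
  then have "Th ?E"
    by (simp add: Th_closure_iff)
  then show "LE A B" "LE B A"
    unfolding LE_def by (rule Th_taut1, auto)+
qed

lemma LE_sum_left: "LE A (A \<^bold>+ B)"
  unfolding LE_def by (rule Th_taut1[OF Th_sum[of 0 1 A B]]) auto

lemma provable_Leq:
  assumes "LE A B"
  shows "provable 4 \<Psi> (A \<le>\<^sub>p B)"
proof -
  let ?E = "Atom 0 (A \<^bold>+ B) 1 \<^bold>\<Leftrightarrow> Atom 0 B 1"
  have "Th ?E"
    by (rule Th_taut2[OF assms[unfolded LE_def] Th_sum[of 0 1 A B]]) auto
  then have "Th (closure ?E)"
    by (simp add: Th_closure_iff)
  then have "Th (A \<le>\<^sub>p B)"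
    by (rule Th_taut2[OF _ Th_equation(1)[OF refl]]) auto
  then show ?thesis
    by (intro Th_closed) auto
qed

text \<open>By residuation the identity lies below an arrow as soon as the product of
  \<open>A\<close> with the identity lies below \<open>B\<close>. Each of the theorems thereby
  becomes an inclusion.\<close>

lemma provable_arrow:
  assumes "LE A B"
  shows "provable 4 \<Psi> (1\<^sub>p \<le>\<^sub>p A \<^bold>\<rightarrow> B)"
  using provable_Leq LE_arrowI LE_trans LE_right_ident assms by blast

end

section \<open>The five inclusions from density and commutativity\<close>

locale commutative_dense = four_variables "density \<union> commutativity"
begin

lemma LE_commute: "LE (A \<^bold>; B) (B \<^bold>; A)"
  by (rule LE_hyp) (auto simp: commutativity_def)

lemma LE_dense: "LE A (A \<^bold>; A)"
  using LE_trans[OF LE_sum_left LE_hyp(1), of A "A \<^bold>; A" "A \<^bold>; A"] by (auto simp: density_def)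

lemma LE_assertion: "LE A ((A \<^bold>\<rightarrow> B) \<^bold>\<rightarrow> B)"
  by (rule LE_arrowI) (rule LE_trans[OF LE_commute LE_modus_ponens])

text \<open>Unfolded, the two sides are complements of products of the converses of \<open>A\<close>
  and \<open>B\<close>, up to double complement and in opposite orders.\<close>

lemma LE_contraposition: "LE (A \<^bold>\<rightarrow> \<^bold>\<sim>B) (B \<^bold>\<rightarrow> \<^bold>\<sim>A)"
proof (rule LE_compl)
  have "LE (B\<^sup>\<smile> \<^bold>; \<^bold>-\<^bold>\<sim>A) (B\<^sup>\<smile> \<^bold>; A\<^sup>\<smile>)"
    by (intro LE_relprod_mono LE_refl LE_compl_compl)
  moreover have "LE (A\<^sup>\<smile> \<^bold>; B\<^sup>\<smile>) (A\<^sup>\<smile> \<^bold>; \<^bold>-\<^bold>\<sim>B)"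
    by (intro LE_relprod_mono LE_refl LE_compl_compl)
  ultimately show "LE (B\<^sup>\<smile> \<^bold>; \<^bold>-\<^bold>\<sim>A) (A\<^sup>\<smile> \<^bold>; \<^bold>-\<^bold>\<sim>B)"
    using LE_commute LE_trans by blast
qed

lemma LE_left_commute: "LE (A \<^bold>; (B \<^bold>; C)) (B \<^bold>; (A \<^bold>; C))"
  using LE_assoc1 LE_assoc2 LE_relprod_mono[OF LE_commute LE_refl] LE_trans by meson

lemma LE_modus_ponens2: "LE (B \<^bold>; (A \<^bold>; (A \<^bold>\<rightarrow> (B \<^bold>\<rightarrow> C)))) C"
  using LE_relprod_mono[OF LE_refl LE_modus_ponens] LE_modus_ponens LE_trans by blast

lemma LE_permutation: "LE (A \<^bold>\<rightarrow> (B \<^bold>\<rightarrow> C)) (B \<^bold>\<rightarrow> (A \<^bold>\<rightarrow> C))"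
  using LE_trans[OF LE_left_commute LE_modus_ponens2] by (intro LE_arrowI)

lemma LE_suffixing: "LE (A \<^bold>\<rightarrow> B) ((B \<^bold>\<rightarrow> C) \<^bold>\<rightarrow> (A \<^bold>\<rightarrow> C))"
proof (intro LE_arrowI)
  have "LE (A \<^bold>; ((B \<^bold>\<rightarrow> C) \<^bold>; (A \<^bold>\<rightarrow> B))) ((B \<^bold>\<rightarrow> C) \<^bold>; B)"
    using LE_trans[OF LE_left_commute LE_relprod_mono[OF LE_refl LE_modus_ponens]] .
  then show "LE (A \<^bold>; ((B \<^bold>\<rightarrow> C) \<^bold>; (A \<^bold>\<rightarrow> B))) C"
    using LE_commute LE_modus_ponens LE_trans by blast
qed

text \<open>Density supplies a second copy of \<open>A\<close>, and one copy is moved past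
  \<open>?X\<close>; then each copy meets its own arrow.\<close>

lemma LE_distribution: "LE (A \<^bold>\<rightarrow> (B \<^bold>\<rightarrow> C)) ((A \<^bold>\<rightarrow> B) \<^bold>\<rightarrow> (A \<^bold>\<rightarrow> C))"
proof (intro LE_arrowI)
  let ?X = "A \<^bold>\<rightarrow> B" and ?Y = "A \<^bold>\<rightarrow> (B \<^bold>\<rightarrow> C)"
  have "LE (A \<^bold>; (?X \<^bold>; ?Y)) ((A \<^bold>; A) \<^bold>; (?X \<^bold>; ?Y))"
    by (intro LE_relprod_mono LE_dense LE_refl)
  also note [trans] = LE_trans
  have "LE \<dots> (A \<^bold>; (A \<^bold>; (?X \<^bold>; ?Y)))"
    by (rule LE_assoc2)
  also have "LE \<dots> (A \<^bold>; (?X \<^bold>; (A \<^bold>; ?Y)))"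
    by (intro LE_relprod_mono LE_refl LE_left_commute)
  also have "LE \<dots> ((A \<^bold>; ?X) \<^bold>; (A \<^bold>; ?Y))"
    by (rule LE_assoc1)
  also have "LE \<dots> (B \<^bold>; (B \<^bold>\<rightarrow> C))"
    by (intro LE_relprod_mono LE_modus_ponens)
  also have "LE \<dots> C"
    by (rule LE_modus_ponens)
  finally show "LE (A \<^bold>; (?X \<^bold>; ?Y)) C" .
qed

lemma theorems_TR:
  "A \<^bold>\<rightarrow> ((A \<^bold>\<rightarrow> B) \<^bold>\<rightarrow> B) \<in> TR"
  "(A \<^bold>\<rightarrow> \<^bold>\<sim>B) \<^bold>\<rightarrow> (B \<^bold>\<rightarrow> \<^bold>\<sim>A) \<in> TR"
  "(A \<^bold>\<rightarrow> (B \<^bold>\<rightarrow> C)) \<^bold>\<rightarrow> (B \<^bold>\<rightarrow> (A \<^bold>\<rightarrow> C)) \<in> TR"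
  "(A \<^bold>\<rightarrow> B) \<^bold>\<rightarrow> ((B \<^bold>\<rightarrow> C) \<^bold>\<rightarrow> (A \<^bold>\<rightarrow> C)) \<in> TR"
  "(A \<^bold>\<rightarrow> (B \<^bold>\<rightarrow> C)) \<^bold>\<rightarrow> ((A \<^bold>\<rightarrow> B) \<^bold>\<rightarrow> (A \<^bold>\<rightarrow> C)) \<in> TR"
  unfolding TR_def
  by (auto intro!: provable_arrow LE_assertion LE_contraposition LE_permutation LE_suffixing
      LE_distribution)

end

section \<open>Frames\<close>

locale cr_star_frame =
  fixes \<KK> :: "'k frame"
  assumes frame: "CR_star_frame \<KK>"
begin

abbreviation K where "K \<equiv> points \<KK>"
abbreviation R where "R a b c \<equiv> (a, b, c) \<in> acc \<KK>"
abbreviation st (\<open>_\<^sup>\<star>\<close> [1000] 1000) where "a\<^sup>\<star> \<equiv> star \<KK> a"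

lemma pre: "pre_CR_star_frame \<KK>"
  using frame unfolding CR_star_frame_def by (rule conjunct1)

lemma is_frame: "is_frame \<KK>"
  using pre unfolding pre_CR_star_frame_def by (rule conjunct1)

lemma acc_points: "R a b c \<Longrightarrow> a \<in> K \<and> b \<in> K \<and> c \<in> K"
  using is_frame unfolding is_frame_def by auto

lemma star_points [simp]: "a \<in> K \<Longrightarrow> a\<^sup>\<star> \<in> K"
  using is_frame unfolding is_frame_def by auto

lemma star_star [simp]: "a \<in> K \<Longrightarrow> a\<^sup>\<star>\<^sup>\<star> = a"
  using pre unfolding pre_CR_star_frame_def by (elim conjE) (erule bspec)

lemma acc_diag: "a \<in> K \<Longrightarrow> R a a a"
  using pre unfolding pre_CR_star_frame_def by (elim conjE) (erule bspec)

lemma acc_star: "a \<in> K \<Longrightarrow> b \<in> K \<Longrightarrow> c \<in> K \<Longrightarrow> R a b c \<longleftrightarrow> R a c\<^sup>\<star> b\<^sup>\<star>"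
  by (rule frame[unfolded CR_star_frame_def, THEN conjunct2, THEN conjunct2, rule_format])

lemma pasch: "R a b x \<Longrightarrow> R x c d \<Longrightarrow> \<exists>y. R a c y \<and> R y b d"
  using frame[unfolded CR_star_frame_def, THEN conjunct2, THEN conjunct1, rule_format, of a b c d]
    acc_points by blast

definition zero where "zero = the_elem (units \<KK>)"

lemma zero: "units \<KK> = {zero}" "zero \<in> K" "a \<in> K \<Longrightarrow> b \<in> K \<Longrightarrow> R zero a b \<longleftrightarrow> a = b"
proof -
  obtain z where z: "units \<KK> = {z}" "\<forall>a\<in>K. \<forall>b\<in>K. R z a b \<longleftrightarrow> a = b" "units \<KK> \<subseteq> K"
    using pre[unfolded pre_CR_star_frame_def, THEN conjunct2, THEN conjunct1]
      is_frame[unfolded is_frame_def, THEN conjunct2, THEN conjunct2] by (elim exE conjE)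
  moreover have "zero = z"
    using z(1) by (simp add: zero_def)
  ultimately show "units \<KK> = {zero}" "zero \<in> K" "a \<in> K \<Longrightarrow> b \<in> K \<Longrightarrow> R zero a b \<longleftrightarrow> a = b"
    by auto
qed

lemma acc_commute: "R a b c \<Longrightarrow> R b a c"
  using pasch[of zero a a b c] acc_points zero by blast

text \<open>The diagonal instance at the star of 0 is turned by the star postulate and commutativity
  into an instance with 0 in front, where accessibility is equality.\<close>

lemma zero_star: "zero\<^sup>\<star> = zero"
proof -
  have "R zero\<^sup>\<star> zero zero"
    using acc_diag[of "zero\<^sup>\<star>"] acc_star[of "zero\<^sup>\<star>" "zero\<^sup>\<star>" "zero\<^sup>\<star>"] zero(2) by simp
  then have "R zero zero\<^sup>\<star> zero"
    by (rule acc_commute)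
  then show ?thesis
    using zero by simp
qed

text \<open>
  The arrow of the complex algebra is the residual of the accessibility relation conjugated by the
  star, which satisfies the same postulates.
\<close>

definition Q where "Q a b c \<longleftrightarrow> R a\<^sup>\<star> b\<^sup>\<star> c\<^sup>\<star> \<and> a \<in> K \<and> b \<in> K \<and> c \<in> K"

lemma Q_points: "Q a b c \<Longrightarrow> a \<in> K \<and> b \<in> K \<and> c \<in> K"
  by (simp add: Q_def)

lemma Q_commute: "Q a b c \<Longrightarrow> Q b a c"
  using acc_commute by (auto simp: Q_def)

lemma Q_star: "Q a b c \<Longrightarrow> Q a c\<^sup>\<star> b\<^sup>\<star>"
  using acc_star[of "a\<^sup>\<star>" "b\<^sup>\<star>" "c\<^sup>\<star>"] by (auto simp: Q_def)

lemma Q_diag: "a \<in> K \<Longrightarrow> Q a a a"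
  using acc_diag by (auto simp: Q_def)

lemma Q_zero:
  assumes "Q a zero b"
  shows "a = b"
proof -
  have K: "a \<in> K" "b \<in> K" and "R a\<^sup>\<star> zero b\<^sup>\<star>"
    using assms zero_star by (auto simp: Q_def)
  then have "R zero a\<^sup>\<star> b\<^sup>\<star>"
    using acc_commute by blast
  then have "a\<^sup>\<star> = b\<^sup>\<star>"
    using zero(3) K by simp
  then have "a\<^sup>\<star>\<^sup>\<star> = b\<^sup>\<star>\<^sup>\<star>"
    by simp
  then show ?thesis
    using K by simp
qed

lemma Q_pasch:
  assumes "Q a b x" "Q x c d"
  shows "\<exists>y. Q a c y \<and> Q y b d"
proof -
  obtain y where y: "R a\<^sup>\<star> c\<^sup>\<star> y" "R y b\<^sup>\<star> d\<^sup>\<star>"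
    using pasch assms unfolding Q_def by blast
  moreover have "y\<^sup>\<star>\<^sup>\<star> = y"
    using y acc_points by simp
  ultimately show ?thesis
    using assms acc_points[OF y(1)] unfolding Q_def by (intro exI[of _ "y\<^sup>\<star>"]) simp
qed

end

section \<open>Valuations: the five inclusions in a frame\<close>

locale cr_star_valuation = cr_star_frame \<KK> for \<KK> :: "'k frame" +
  fixes h
  assumes hom: "homomorphism predicate_algebra (complex_algebra \<KK>) h"
begin

lemma h_points: "h A \<subseteq> K"
  using hom unfolding homomorphism_def predicate_algebra_def complex_algebra_def by auto

lemma h_simps:
  "h (\<^bold>-A) = K - h A"
  "h (A \<^bold>; B) = {z. \<exists>x\<in>h A. \<exists>y\<in>h B. R x y z}"
  "h (A\<^sup>\<smile>) = star \<KK> ` h A"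
  using hom unfolding homomorphism_def predicate_algebra_def complex_algebra_def by simp_all

lemma Q_iff: "a \<in> K \<Longrightarrow> b \<in> K \<Longrightarrow> z \<in> K \<Longrightarrow> Q a z b \<longleftrightarrow> R a\<^sup>\<star> b z"
  using acc_star[of "a\<^sup>\<star>" b z] by (auto simp: Q_def)

text \<open>A point z outside the arrow has witnesses a in \<open>A\<close> and b outside
  \<open>B\<close> with \<open>R\<close> relating the star of a and b to z. The star postulate
  rotates this into \<open>Q a z b\<close>, so the arrow obeys the usual ternary clause for
  \<open>Q\<close>.\<close>

lemma h_arrow: "z \<in> h (A \<^bold>\<rightarrow> B) \<longleftrightarrow> z \<in> K \<and> (\<forall>a\<in>h A. \<forall>b. Q a z b \<longrightarrow> b \<in> h B)"
proof -
  have "z \<in> h (A \<^bold>\<rightarrow> B) \<longleftrightarrow> z \<in> K \<and> (\<forall>a\<in>h A. \<forall>b\<in>K - h B. \<not> R a\<^sup>\<star> b z)"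
    by (auto simp: h_simps)
  then show ?thesis
    using Q_iff h_points Q_points by blast
qed

lemma h_arrow2I:
  assumes "z \<in> K" "\<And>a b x y. a \<in> h A \<Longrightarrow> Q a z x \<Longrightarrow> b \<in> h B \<Longrightarrow> Q b x y \<Longrightarrow> y \<in> h C"
  shows "z \<in> h (A \<^bold>\<rightarrow> (B \<^bold>\<rightarrow> C))"
proof -
  have "x \<in> h (B \<^bold>\<rightarrow> C)" if "a \<in> h A" "Q a z x" for a x
    using assms(2)[OF that] Q_points[OF that(2)] unfolding h_arrow[of x B C] by blast
  then show ?thesis
    using assms(1) h_arrow[of z A] by blast
qed

lemma h_arrowD: "z \<in> h (A \<^bold>\<rightarrow> B) \<Longrightarrow> a \<in> h A \<Longrightarrow> Q a z b \<Longrightarrow> b \<in> h B"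
  using h_arrow by blast

lemma h_neg: "z \<in> h (\<^bold>\<sim>A) \<longleftrightarrow> z \<in> K \<and> z\<^sup>\<star> \<notin> h A"
proof (cases "z \<in> K")
  case True
  have "z \<in> star \<KK> ` h A \<longleftrightarrow> z\<^sup>\<star> \<in> h A"
  proof
    assume "z \<in> star \<KK> ` h A"
    then obtain a where "a \<in> h A" "z = a\<^sup>\<star>"
      by blast
    moreover have "a\<^sup>\<star>\<^sup>\<star> = a"
      using h_points[of A] \<open>a \<in> h A\<close> by (intro star_star) blast
    ultimately show "z\<^sup>\<star> \<in> h A"
      by simp
  next
    assume "z\<^sup>\<star> \<in> h A"
    then show "z \<in> star \<KK> ` h A"
      using star_star[OF True] by (intro image_eqI[of _ _ "z\<^sup>\<star>"]) simp_all
  qed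
  then show ?thesis
    using True unfolding h_simps by blast
qed (simp add: h_simps)

lemma zero_arrow: "h A \<subseteq> h B \<Longrightarrow> units \<KK> \<subseteq> h (A \<^bold>\<rightarrow> B)"
  using Q_zero zero by (auto simp: h_arrow)

lemma h_assertion: "h A \<subseteq> h ((A \<^bold>\<rightarrow> B) \<^bold>\<rightarrow> B)"
proof
  fix z assume "z \<in> h A"
  then show "z \<in> h ((A \<^bold>\<rightarrow> B) \<^bold>\<rightarrow> B)"
    using h_points[of A] Q_commute by (auto simp: h_arrow)
qed

text \<open>Commuting around \<open>Q_star\<close> turns \<open>Q b z a\<close> into the
  \<open>Q\<close>-triple of the star of a, z, and the star of b.\<close>

lemma h_contraposition: "h (A \<^bold>\<rightarrow> \<^bold>\<sim>B) \<subseteq> h (B \<^bold>\<rightarrow> \<^bold>\<sim>A)"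
proof
  fix z assume z: "z \<in> h (A \<^bold>\<rightarrow> \<^bold>\<sim>B)"
  have "a\<^sup>\<star> \<notin> h A" if "b \<in> h B" "Q b z a" for a b
  proof
    assume "a\<^sup>\<star> \<in> h A"
    moreover have "Q a\<^sup>\<star> z b\<^sup>\<star>"
      using that(2) Q_commute Q_star by blast
    ultimately have "b\<^sup>\<star>\<^sup>\<star> \<notin> h B"
      using z h_neg unfolding h_arrow by blast
    then show False
      using that Q_points by auto
  qed
  then show "z \<in> h (B \<^bold>\<rightarrow> \<^bold>\<sim>A)"
    using z Q_points unfolding h_arrow h_neg by blast
qed

lemma h_permutation: "h (A \<^bold>\<rightarrow> (B \<^bold>\<rightarrow> C)) \<subseteq> h (B \<^bold>\<rightarrow> (A \<^bold>\<rightarrow> C))"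
proof (intro subsetI h_arrow2I)
  fix z b a x y
  assume z: "z \<in> h (A \<^bold>\<rightarrow> (B \<^bold>\<rightarrow> C))" and b: "b \<in> h B" "Q b z x" and a: "a \<in> h A" "Q a x y"
  obtain w where w: "Q z a w" "Q w b y"
    using Q_pasch[OF Q_commute[OF b(2)] Q_commute[OF a(2)]] by blast
  have "w \<in> h (B \<^bold>\<rightarrow> C)"
    using h_arrowD[OF z a(1) Q_commute[OF w(1)]] .
  then show "y \<in> h C"
    using h_arrowD b(1) Q_commute[OF w(2)] by blast
qed (use h_points in blast)

lemma h_suffixing: "h (A \<^bold>\<rightarrow> B) \<subseteq> h ((B \<^bold>\<rightarrow> C) \<^bold>\<rightarrow> (A \<^bold>\<rightarrow> C))"
proof (intro subsetI h_arrow2I)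
  fix z f a x y
  assume z: "z \<in> h (A \<^bold>\<rightarrow> B)" and f: "f \<in> h (B \<^bold>\<rightarrow> C)" "Q f z x" and a: "a \<in> h A" "Q a x y"
  obtain w where w: "Q z a w" "Q w f y"
    using Q_pasch[OF Q_commute[OF f(2)] Q_commute[OF a(2)]] by blast
  have "w \<in> h B"
    using h_arrowD[OF z a(1) Q_commute[OF w(1)]] .
  then show "y \<in> h C"
    using h_arrowD[OF f(1) _ w(2)] by blast
qed (use h_points in blast)

text \<open>Semantic form of the density argument: the diagonal \<open>Q a a a\<close> lets the
  single point a act twice, and two further Pasch steps send one copy to z and the other to
  f.\<close>

lemma h_distribution: "h (A \<^bold>\<rightarrow> (B \<^bold>\<rightarrow> C)) \<subseteq> h ((A \<^bold>\<rightarrow> B) \<^bold>\<rightarrow> (A \<^bold>\<rightarrow> C))"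
proof (intro subsetI h_arrow2I)
  fix z f a x y
  assume z: "z \<in> h (A \<^bold>\<rightarrow> (B \<^bold>\<rightarrow> C))" and f: "f \<in> h (A \<^bold>\<rightarrow> B)" "Q f z x"
    and a: "a \<in> h A" "Q a x y"
  obtain w where w: "Q a x w" "Q w a y"
    using Q_pasch[OF Q_diag a(2)] Q_points a(2) by blast
  obtain u where u: "Q z a u" "Q u f w"
    using Q_pasch[OF Q_commute[OF f(2)] Q_commute[OF w(1)]] by blast
  obtain v where v: "Q f a v" "Q v u y"
    using Q_pasch[OF Q_commute[OF u(2)] w(2)] by blast
  have "u \<in> h (B \<^bold>\<rightarrow> C)"
    using h_arrowD[OF z a(1) Q_commute[OF u(1)]] .
  moreover have "v \<in> h B"
    using h_arrowD[OF f(1) a(1) Q_commute[OF v(1)]] .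
  ultimately show "y \<in> h C"
    using h_arrowD v(2) by blast
qed (use h_points in blast)

end

lemma valid_arrowI:
  assumes "CR_star_frame \<KK>" "\<And>h. cr_star_valuation \<KK> h \<Longrightarrow> h A \<subseteq> h B"
  shows "valid \<KK> (A \<^bold>\<rightarrow> B)"
  unfolding valid_def
proof (intro allI impI)
  fix h assume "homomorphism predicate_algebra (complex_algebra \<KK>) h"
  then interpret cr_star_valuation \<KK> h
    using assms(1) by unfold_locales
  show "units \<KK> \<subseteq> h (A \<^bold>\<rightarrow> B)"
    using zero_arrow assms(2) cr_star_valuation_axioms by blast
qed

lemma R_logicI:
  "P \<in> relevance_predicates \<Longrightarrow> (\<And>\<KK> :: 'k frame. CR_star_frame \<KK> \<Longrightarrow> valid \<KK> P) \<Longrightarrow>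
    P \<in> R_logic TYPE('k)"
  by (simp add: R_logic_def CR_star_def)

lemma theorems_R_logic:
  assumes "A \<in> relevance_predicates" "B \<in> relevance_predicates" "C \<in> relevance_predicates"
  shows
  "A \<^bold>\<rightarrow> ((A \<^bold>\<rightarrow> B) \<^bold>\<rightarrow> B) \<in> R_logic TYPE('k)"
  "(A \<^bold>\<rightarrow> \<^bold>\<sim>B) \<^bold>\<rightarrow> (B \<^bold>\<rightarrow> \<^bold>\<sim>A) \<in> R_logic TYPE('k)"
  "(A \<^bold>\<rightarrow> (B \<^bold>\<rightarrow> C)) \<^bold>\<rightarrow> (B \<^bold>\<rightarrow> (A \<^bold>\<rightarrow> C)) \<in> R_logic TYPE('k)"
  "(A \<^bold>\<rightarrow> B) \<^bold>\<rightarrow> ((B \<^bold>\<rightarrow> C) \<^bold>\<rightarrow> (A \<^bold>\<rightarrow> C)) \<in> R_logic TYPE('k)"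
  "(A \<^bold>\<rightarrow> (B \<^bold>\<rightarrow> C)) \<^bold>\<rightarrow> ((A \<^bold>\<rightarrow> B) \<^bold>\<rightarrow> (A \<^bold>\<rightarrow> C)) \<in> R_logic TYPE('k)"
  by (intro R_logicI valid_arrowI relevance_predicates.arrow relevance_predicates.neg assms
      cr_star_valuation.h_assertion cr_star_valuation.h_contraposition
      cr_star_valuation.h_permutation cr_star_valuation.h_suffixing
      cr_star_valuation.h_distribution; assumption)+

section \<open>Soundness in relational models\<close>

text \<open>Interpretation by arbitrary binary relations on one base, complements being taken in the
  full relation. The clauses are assumed instead of defined by recursion so that the tree can supply
  them through its finite algebra.\<close>

locale relational_model =
  fixes I :: "predicate \<Rightarrow> 'u \<Rightarrow> 'u \<Rightarrow> bool"
  assumes I_ident [simp]: "I 1\<^sub>p x y \<longleftrightarrow> x = y"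
    and I_sum [simp]: "I (A \<^bold>+ B) x y \<longleftrightarrow> I A x y \<or> I B x y"
    and I_compl [simp]: "I (\<^bold>-A) x y \<longleftrightarrow> \<not> I A x y"
    and I_relprod [simp]: "I (A \<^bold>; B) x y \<longleftrightarrow> (\<exists>z. I A x z \<and> I B z y)"
    and I_conv [simp]: "I (A\<^sup>\<smile>) x y \<longleftrightarrow> I A y x"
begin

primrec sat :: "(nat \<Rightarrow> 'u) \<Rightarrow> fm \<Rightarrow> bool" where
  "sat s (Atom x A y) \<longleftrightarrow> I A (s x) (s y)"
| "sat s (A \<doteq> B) \<longleftrightarrow> I A = I B"
| "sat s (\<phi> \<^bold>\<Rightarrow> \<psi>) \<longleftrightarrow> (sat s \<phi> \<longrightarrow> sat s \<psi>)"
| "sat s (\<^bold>\<not>\<phi>) \<longleftrightarrow> \<not> sat s \<phi>"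
| "sat s (Forall x \<phi>) \<longleftrightarrow> (\<forall>u. sat (s(x := u)) \<phi>)"

lemma sat_cong: "(\<And>x. x \<in> free_vars \<phi> \<Longrightarrow> s x = t x) \<Longrightarrow> sat s \<phi> \<longleftrightarrow> sat t \<phi>"
proof (induction \<phi> arbitrary: s t)
  case (Forall x \<phi>)
  have "sat (s(x := u)) \<phi> \<longleftrightarrow> sat (t(x := u)) \<phi>" for u
    using Forall by (intro Forall.IH) auto
  then show ?case
    by simp
next
  case (Imp \<phi> \<psi>)
  have "sat s \<phi> \<longleftrightarrow> sat t \<phi>" "sat s \<psi> \<longleftrightarrow> sat t \<psi>"
    by (rule Imp.IH; simp add: Imp.prems)+
  then show ?case
    by simp
next
  case (FNot \<phi>)
  have "sat s \<phi> \<longleftrightarrow> sat t \<phi>"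
    by (rule FNot.IH) (simp add: FNot.prems)
  then show ?case
    by simp
qed auto

lemma sat_foldr_Forall:
  "sat s (foldr Forall xs \<phi>) \<longleftrightarrow> (\<forall>t. (\<forall>y. y \<notin> set xs \<longrightarrow> t y = s y) \<longrightarrow> sat t \<phi>)"
proof (induction xs arbitrary: s)
  case Nil
  have "t = s" if "\<forall>y. t y = s y" for t
    using that by auto
  then show ?case
    by auto
next
  case (Cons x xs)
  have "(\<exists>u. \<forall>y. y \<notin> set xs \<longrightarrow> t y = (s(x := u)) y) \<longleftrightarrow> (\<forall>y. y \<notin> set (x # xs) \<longrightarrow> t y = s y)" for t
    by (auto intro!: exI[of _ "t x"])
  then have "(\<forall>u. \<forall>t. (\<forall>y. y \<notin> set xs \<longrightarrow> t y = (s(x := u)) y) \<longrightarrow> sat t \<phi>) \<longleftrightarrow>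
    (\<forall>t. (\<forall>y. y \<notin> set (x # xs) \<longrightarrow> t y = s y) \<longrightarrow> sat t \<phi>)"
    by blast
  then show ?case
    using Cons.IH by simp
qed

lemma sat_closure [simp]: "sat s (closure \<phi>) \<longleftrightarrow> (\<forall>t. sat t \<phi>)"
proof
  assume *: "sat s (closure \<phi>)"
  show "\<forall>t. sat t \<phi>"
  proof
    fix t
    let ?t = "\<lambda>y. if y \<in> free_vars \<phi> then t y else s y"
    have "sat ?t \<phi>"
      using * unfolding closure_def sat_foldr_Forall by simp
    moreover have "sat ?t \<phi> \<longleftrightarrow> sat t \<phi>"
      by (rule sat_cong) simp
    ultimately show "sat t \<phi>"
      by simp
  qed
qed (simp add: closure_def sat_foldr_Forall)

lemma axioms_sound: "\<phi> \<in> axioms \<infinity> \<Longrightarrow> sat s \<phi>"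
proof (induction rule: axioms.induct)
  case (all_commute \<phi> x y)
  then show ?case
    by (cases "x = y") (auto simp: fun_upd_twist)
next
  case (all_elim \<phi> x)
  have "sat t \<phi>" if "\<forall>u. sat (t(x := u)) \<phi>" for t
    using that[rule_format, of "t x"] by simp
  then show ?case
    by simp
next
  case (all_vacuous \<phi> x)
  have "sat (t(x := u)) \<phi> \<longleftrightarrow> sat t \<phi>" for t u
    using all_vacuous by (intro sat_cong) auto
  then show ?case
    by simp
next
  case (equation A B)
  have "I A = I B \<longleftrightarrow> (\<forall>t :: nat \<Rightarrow> 'u. I A (t 0) (t 1) \<longleftrightarrow> I B (t 0) (t 1))"
  proof
    assume *: "\<forall>t :: nat \<Rightarrow> 'u. I A (t 0) (t 1) \<longleftrightarrow> I B (t 0) (t 1)"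
    have "I A u w \<longleftrightarrow> I B u w" for u w
      using *[rule_format, of "\<lambda>i. if i = 0 then u else w"] by simp
    then show "I A = I B"
      by blast
  qed simp
  then show ?case
    by auto
qed auto

lemma provable_sound: "provable \<infinity> {} \<phi> \<Longrightarrow> sat s \<phi>"
  by (induction rule: provable.induct) (auto simp: axioms_sound)

text \<open>The provable equation becomes an equality of relations. At (x, x) its left side holds
  because of the identity summand.\<close>

lemma CT_omega_sound: "P \<in> CT_omega \<Longrightarrow> I P x x"
  using provable_sound[of "1\<^sub>p \<le>\<^sub>p P"] unfolding CT_omega_def by (auto simp: fun_eq_iff)

section \<open>Soundness of the sequent calculus\<close>

definition true_at :: "(nat \<Rightarrow> 'u) \<Rightarrow> atom \<Rightarrow> bool" where
  "true_at s = (\<lambda>(x, A, y). I A (s x) (s y))"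

lemma true_at [simp]: "true_at s (x, A, y) \<longleftrightarrow> I A (s x) (s y)"
  by (simp add: true_at_def)

text \<open>A sequent is read as: if all formulas on the left hold, then one on the right does. This
  reading covers infinite sides as well.\<close>

lemma derivable_sound:
  assumes "derivable \<Xi> \<Gamma> \<Delta>" "\<And>X Y. X \<doteq> Y \<in> \<Xi> \<Longrightarrow> I X = I Y" "\<forall>a\<in>\<Gamma>. true_at s a"
  shows "\<exists>a\<in>\<Delta>. true_at s a"
  using assms(1,3)
proof (induction arbitrary: s rule: derivable.induct)
  case (axiom_ident x \<Delta> \<Gamma>)
  then show ?case
    by (intro bexI[of _ "(x, 1\<^sub>p, x)"]) simp_all
next
  case (equation_lr X Y i j \<Gamma> \<Delta>)
  then show ?case
    using assms(2)[OF equation_lr.hyps] by simp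
next
  case (equation_rl X Y i j \<Gamma> \<Delta>)
  then show ?case
    using assms(2)[OF equation_rl.hyps] by simp
next
  case (relprod_left x A y B z \<Gamma> \<Delta>)
  obtain u where u: "I A (s x) u" "I B u (s z)"
    using relprod_left.prems by auto
  \<comment> \<open>The eigenvariable is sent to the intermediate point; by freshness the side
    formulas keep their truth values.\<close>
  let ?t = "s(y := u)"
  have fresh: "true_at ?t a \<longleftrightarrow> true_at s a" if "a \<in> \<Gamma> \<union> \<Delta>" for a
  proof -
    obtain v C w where "a = (v, C, w)"
      by (cases a)
    moreover have "v \<noteq> y \<and> w \<noteq> y"
      using bspec[OF relprod_left.hyps(4) that] calculation by simp
    ultimately show ?thesis
      by simp
  qed
  have "\<forall>a\<in>insert (x, A, y) (insert (y, B, z) \<Gamma>). true_at ?t a"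
    using u relprod_left.hyps(2,3) relprod_left.prems fresh by simp
  then have "\<exists>a\<in>\<Delta>. true_at ?t a"
    by (rule relprod_left.IH)
  then show ?case
    using fresh by blast
next
  case (relprod_right \<Gamma> x A y \<Delta> \<Gamma>' B z \<Delta>')
  show ?case
    using relprod_right.IH[of s] relprod_right.prems by (simp add: ball_Un bex_Un) blast
next
  case (cut \<Gamma> x A y \<Delta> \<Gamma>' \<Delta>')
  show ?case
    using cut.IH[of s] cut.prems by (simp add: ball_Un bex_Un) argo
next
  case (equality x A y \<Gamma> \<Delta> z)
  show ?case
    using equality.IH[of s] equality.prems by simp metis
next
  case (sum_left x A y \<Gamma> \<Delta> B \<Gamma>' \<Delta>')
  show ?case
    using sum_left.IH[of s] sum_left.prems by (simp add: ball_Un bex_Un) argo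
next
  case (sum_right \<Gamma> x A y B \<Delta>)
  show ?case
    using sum_right.IH[of s] sum_right.prems by simp
next
  case (compl_left \<Gamma> x A y \<Delta>)
  show ?case
    using compl_left.IH[of s] compl_left.prems by simp
next
  case (compl_right x A y \<Gamma> \<Delta>)
  show ?case
    using compl_right.IH[of s] compl_right.prems by simp
next
  case (conv_left x A y \<Gamma> \<Delta>)
  show ?case
    using conv_left.IH[of s] conv_left.prems by simp
next
  case (conv_right \<Gamma> x A y \<Delta>)
  show ?case
    using conv_right.IH[of s] conv_right.prems by simp
qed blast

lemma omega_provable_sound:
  assumes "omega_provable \<Xi> P" "\<And>X Y. X \<doteq> Y \<in> \<Xi> \<Longrightarrow> I X = I Y"
  shows "I P x x"
  using derivable_sound[of \<Xi> "{}" "{(0, P, 0)}" "\<lambda>_. x"] assms by (simp add: omega_provable_def)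

end

section \<open>The ordered tree\<close>

text \<open>
  A node of level \<open>q\<close> is reached by taking the branch \<open>f r\<close> at each earlier level \<open>r\<close>. Finiteness of
  the support gives incomparable nodes a first level at which they differ and any two nodes a
  common lower bound.
\<close>

typedef node = "{(q :: rat, f :: rat \<Rightarrow> int). finite {r. f r \<noteq> 0} \<and> (\<forall>r\<ge>q. f r = 0)}"
  by (rule exI[of _ "(0, \<lambda>_. 0)"]) simp

definition lev :: "node \<Rightarrow> rat" where "lev x = fst (Rep_node x)"
definition lab :: "node \<Rightarrow> rat \<Rightarrow> int" where "lab x = snd (Rep_node x)"

text \<open>Erasing the labels from level q on yields a legal representative for every f of finite
  support.\<close>

definition mk :: "rat \<Rightarrow> (rat \<Rightarrow> int) \<Rightarrow> node" where
  "mk q f = Abs_node (q, \<lambda>r. if r < q then f r else 0)"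

lemma Rep_node_eq: "Rep_node x = (lev x, lab x)"
  by (simp add: lev_def lab_def)

lemma finite_lab: "finite {r. lab x r \<noteq> 0}" and lab_beyond: "lev x \<le> r \<Longrightarrow> lab x r = 0"
  using Rep_node[of x] by (auto simp: Rep_node_eq)

lemma node_eqI:
  assumes "lev x = lev y" "\<And>r. r < lev x \<Longrightarrow> lab x r = lab y r"
  shows "x = y"
proof -
  have "lab x r = lab y r" for r
    using assms lab_beyond[of x r] lab_beyond[of y r] by (cases "r < lev x") auto
  then have "Rep_node x = Rep_node y"
    using assms by (auto simp: Rep_node_eq)
  then show ?thesis
    by (simp add: Rep_node_inject)
qed

lemma mk:
  assumes "finite {r. f r \<noteq> 0}"
  shows "lev (mk q f) = q" "lab (mk q f) r = (if r < q then f r else 0)"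
proof -
  have "finite {r. (if r < q then f r else 0) \<noteq> 0}"
    using assms by (rule finite_subset[rotated]) auto
  then have "Rep_node (mk q f) = (q, \<lambda>r. if r < q then f r else 0)"
    unfolding mk_def by (intro Abs_node_inverse) simp
  then show "lev (mk q f) = q" "lab (mk q f) r = (if r < q then f r else 0)"
    by (simp_all add: lev_def lab_def)
qed

definition above :: "node \<Rightarrow> node \<Rightarrow> bool" where
  "above x y \<longleftrightarrow> lev y < lev x \<and> (\<forall>r < lev y. lab x r = lab y r)"

text \<open>The lexicographic order confined to incomparable nodes: r is the first level of
  disagreement and lies below both nodes.\<close>

definition left_at :: "rat \<Rightarrow> node \<Rightarrow> node \<Rightarrow> bool" where
  "left_at r x y \<longleftrightarrow> r < lev x \<and> r < lev y \<and> (\<forall>s<r. lab x s = lab y s) \<and> lab x r < lab y r"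

definition left :: "node \<Rightarrow> node \<Rightarrow> bool" where
  "left x y \<longleftrightarrow> (\<exists>r. left_at r x y)"

section \<open>Order laws of the tree\<close>

lemma above_irrefl: "\<not> above x x"
  by (simp add: above_def)

lemma above_trans: "above x y \<Longrightarrow> above y z \<Longrightarrow> above x z"
  unfolding above_def by (metis less_trans)

lemma left_irrefl: "\<not> left x x"
  by (simp add: left_def left_at_def)

lemma left_trans:
  assumes "left x y" "left y z"
  shows "left x z"
proof -
  obtain r s where "left_at r x y" "left_at s y z"
    using assms unfolding left_def by blast
  then have "left_at (min r s) x z"
    unfolding left_at_def by (cases r s rule: linorder_cases) auto
  then show ?thesis
    unfolding left_def by blast
qed

lemma above_left: "above x y \<Longrightarrow> left y z \<Longrightarrow> left x z"
  unfolding above_def left_def left_at_def by (metis less_trans)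

lemma left_below: "left x y \<Longrightarrow> above z y \<Longrightarrow> left x z"
  unfolding above_def left_def left_at_def by (metis less_trans)

text \<open>The outcome depends on whether x and y part below the level of z or not; in the latter
  case z lies on their common part.\<close>

lemma left_above:
  assumes "left x y" "above y z"
  shows "left x z \<or> above x z"
proof -
  obtain r where r: "left_at r x y"
    using assms left_def by blast
  show ?thesis
  proof (cases "r < lev z")
    case True
    then have "left_at r x z"
      using r assms(2) unfolding left_at_def above_def by auto
    then show ?thesis
      unfolding left_def by blast
  next
    case False
    then have "above x z"
      using r assms(2) unfolding left_at_def above_def by auto
    then show ?thesis ..
  qed
qed

lemma below_left:
  assumes "above y x" "left y z"
  shows "above z x \<or> left x z"
proof -
  obtain r where r: "left_at r y z"
    using assms left_def by blast
  show ?thesis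
  proof (cases "r < lev x")
    case True
    then have "left_at r x z"
      using r assms(1) unfolding left_at_def above_def by auto
    then show ?thesis
      unfolding left_def by blast
  next
    case False
    then have "above z x"
      using r assms(1) unfolding left_at_def above_def by auto
    then show ?thesis ..
  qed
qed

text \<open>Nodes below a common node are initial segments of it, so their levels decide.\<close>

lemma below_above:
  assumes "above y x" "above y z"
  shows "x = z \<or> above x z \<or> above z x"
proof (cases "lev x" "lev z" rule: linorder_cases)
  case less
  then have "above z x"
    using assms unfolding above_def by auto
  then show ?thesis by blast
next
  case equal
  then have "x = z"
    using assms unfolding above_def by (intro node_eqI) auto
  then show ?thesis by blast
next
  case greater
  then have "above x z"
    using assms unfolding above_def by auto
  then show ?thesis by blast
qed

lemma above_not_left: "above x y \<Longrightarrow> \<not> left x y" "above x y \<Longrightarrow> \<not> left y x"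
  unfolding above_def left_def left_at_def by auto

text \<open>Finite support makes the set \<open>?D\<close> of levels of disagreement finite. If it
  is empty, one node is an initial segment of the other; otherwise its minimum is the branching
  level.\<close>

lemma node_cases: "x = y \<or> above x y \<or> above y x \<or> left x y \<or> left y x"
proof -
  let ?m = "min (lev x) (lev y)"
  let ?D = "{r. r < ?m \<and> lab x r \<noteq> lab y r}"
  have "?D \<subseteq> {r. lab x r \<noteq> 0} \<union> {r. lab y r \<noteq> 0}"
    by auto
  then have fin: "finite ?D"
    using finite_lab finite_subset by blast
  show ?thesis
  proof (cases "?D = {}")
    case True
    then have agree: "r < ?m \<Longrightarrow> lab x r = lab y r" for r
      by auto
    show ?thesis
    proof (cases "lev x" "lev y" rule: linorder_cases)
      case less
      then have "above y x"
        using agree unfolding above_def by auto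
      then show ?thesis by blast
    next
      case equal
      then have "x = y"
        using agree by (intro node_eqI) auto
      then show ?thesis by blast
    next
      case greater
      then have "above x y"
        using agree unfolding above_def by auto
      then show ?thesis by blast
    qed
  next
    case False
    define r where "r = Min ?D"
    have r: "r < ?m" "lab x r \<noteq> lab y r"
      using Min_in[OF fin False] unfolding r_def by auto
    have least: "lab x s = lab y s" if "s < r" for s
    proof (rule ccontr)
      assume "lab x s \<noteq> lab y s"
      then have "s \<in> ?D"
        using that r by auto
      then show False
        using Min_le[OF fin] that unfolding r_def by fastforce
    qed
    have "left_at r x y \<or> left_at r y x"
      using r least unfolding left_at_def by auto
    then show ?thesis
      unfolding left_def by blast
  qed
qed

section \<open>Witness nodes and the composition table\<close>

definition up :: "node \<Rightarrow> node" where "up x = mk (lev x + 1) (lab x)"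
definition trunc :: "node \<Rightarrow> rat \<Rightarrow> node" where "trunc x p = mk p (lab x)"
text \<open>The path of x, left at level p by shifting the label there by d; the height p + 1 is an
  arbitrary level past p.\<close>

definition branch :: "node \<Rightarrow> rat \<Rightarrow> int \<Rightarrow> node" where
  "branch x p d = mk (p + 1) ((lab x)(p := lab x p + d))"

lemma up [simp]: "lev (up x) = lev x + 1" "r < lev x \<Longrightarrow> lab (up x) r = lab x r"
  using mk[OF finite_lab[of x]] by (auto simp: up_def)

lemma trunc [simp]: "lev (trunc x p) = p" "r < p \<Longrightarrow> lab (trunc x p) r = lab x r"
  using mk[OF finite_lab[of x]] by (auto simp: trunc_def)

lemma branch [simp]:
  "lev (branch x p d) = p + 1"
  "lab (branch x p d) p = lab x p + d"
  "r < p \<Longrightarrow> lab (branch x p d) r = lab x r"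
proof -
  have "finite {r. ((lab x)(p := lab x p + d)) r \<noteq> 0}"
    by (rule finite_subset[of _ "insert p {r. lab x r \<noteq> 0}"]) (auto simp: finite_lab)
  note mk = mk[OF this]
  show "lev (branch x p d) = p + 1" "lab (branch x p d) p = lab x p + d"
    "r < p \<Longrightarrow> lab (branch x p d) r = lab x r"
    unfolding branch_def mk by simp_all
qed

definition cmp :: "node \<Rightarrow> node \<Rightarrow> nat" where
  "cmp x y = (if x = y then 0 else if above x y then 1 else if above y x then 2
     else if left x y then 3 else 4)"

lemma above_asym: "above x y \<Longrightarrow> \<not> above y x"
  using above_trans above_irrefl by blast

lemma left_asym: "left x y \<Longrightarrow> \<not> left y x"
  using left_trans left_irrefl by blast

lemma cmp_iff:
  "cmp x y = 0 \<longleftrightarrow> x = y"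
  "cmp x y = Suc 0 \<longleftrightarrow> above x y"
  "cmp x y = 2 \<longleftrightarrow> above y x"
  "cmp x y = 3 \<longleftrightarrow> left x y"
  "cmp x y = 4 \<longleftrightarrow> left y x"
  using node_cases[of x y] above_irrefl left_irrefl above_asym left_asym above_not_left
  unfolding cmp_def by auto

lemma cmp_less: "cmp x y < 5"
  by (simp add: cmp_def)

text \<open>Composition table: the possible codes of (x, z) when (x, y) has code \<open>a\<close>
  and (y, z) has code \<open>b\<close>. Equality is split off, hence the index shift by one.\<close>

definition table :: "nat \<Rightarrow> nat \<Rightarrow> nat set" where
  "table a b =
    (if a = 0 then {b} else if b = 0 then {a} else
      [[{1}, {0,1,2,3,4}, {3}, {4}],
       [{0,1,2}, {2}, {2,3}, {2,4}],
       [{1,3}, {3}, {3}, {0,1,2,3,4}],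
       [{1,4}, {4}, {0,1,2,3,4}, {4}]] ! (a - 1) ! (b - 1))"

lemma less_5_cases: "a < 5 \<Longrightarrow> a = 0 \<or> a = Suc 0 \<or> a = 2 \<or> a = 3 \<or> a = (4 :: nat)"
  by arith

lemma cmp_compose: "cmp x z \<in> table (cmp x y) (cmp y z)"
proof -
  have val: "above u v \<Longrightarrow> cmp u v = Suc 0" "above v u \<Longrightarrow> cmp u v = 2"
    "left u v \<Longrightarrow> cmp u v = 3" "left v u \<Longrightarrow> cmp u v = 4" for u v
    by (simp_all add: cmp_iff)
  have [simp]: "cmp u u = 0" for u
    by (simp add: cmp_iff)
  show ?thesis
    using node_cases[of x y] node_cases[of y z]
  proof (elim disjE)
  qed (use node_cases[of x z] in \<open>auto simp: val table_def cmp_iff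
      dest: above_trans above_left left_below left_above below_left below_above left_trans\<close>)
qed

text \<open>The seven cases are the entries of \<open>table\<close> that contain 1, apart from the
  row and column of equality. The eight cases of \<open>left_factor\<close> are likewise those
  containing 3.\<close>

lemma above_factor:
  assumes "above x z"
  shows "\<exists>y. above x y \<and> above y z" "\<exists>y. above x y \<and> above z y" "\<exists>y. above y x \<and> above y z"
    "\<exists>y. left x y \<and> above y z" "\<exists>y. left y x \<and> above y z"
    "\<exists>y. left x y \<and> left z y" "\<exists>y. left y x \<and> left y z"
proof -
  note defs = above_def left_def left_at_def
  \<comment> \<open>Rational levels leave room strictly between z and x.\<close>
  let ?p = "(lev x + lev z) / 2"
  have p: "lev z < ?p" "?p < lev x"
    using assms by (auto simp: above_def)
  show "\<exists>y. above x y \<and> above y z"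
    using assms p by (intro exI[of _ "trunc x ?p"]) (auto simp: defs)
  show "\<exists>y. above x y \<and> above z y"
    using assms by (intro exI[of _ "trunc z (lev z - 1)"]) (auto simp: defs)
  show "\<exists>y. above y x \<and> above y z"
    using assms by (intro exI[of _ "up x"]) (auto simp: defs)
  \<comment> \<open>Leaving the path of x exactly at the level of z keeps all labels of z, so the
    new node is still above z.\<close>
  show "\<exists>y. left x y \<and> above y z"
    using assms by (intro exI[of _ "branch x (lev z) 1"] conjI)
      (auto simp: defs intro!: exI[of _ "lev z"])
  show "\<exists>y. left y x \<and> above y z"
    using assms by (intro exI[of _ "branch x (lev z) (-1)"] conjI)
      (auto simp: defs intro!: exI[of _ "lev z"])
  \<comment> \<open>Leaving one level below z, on the part shared with x, passes both nodes.\<close>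
  show "\<exists>y. left x y \<and> left z y"
    using assms by (intro exI[of _ "branch z (lev z - 1) 1"] conjI)
      (auto simp: defs intro!: exI[of _ "lev z - 1"])
  show "\<exists>y. left y x \<and> left y z"
    using assms by (intro exI[of _ "branch z (lev z - 1) (-1)"] conjI)
      (auto simp: defs intro!: exI[of _ "lev z - 1"])
qed

lemma left_factor:
  assumes "left x z"
  shows "\<exists>y. above x y \<and> above z y" "\<exists>y. above x y \<and> left y z" "\<exists>y. above y x \<and> left y z"
    "\<exists>y. left x y \<and> above y z" "\<exists>y. left x y \<and> above z y" "\<exists>y. left x y \<and> left y z"
    "\<exists>y. left x y \<and> left z y" "\<exists>y. left y x \<and> left y z"
proof -
  note defs = above_def left_def left_at_def
  obtain r where r: "left_at r x z"
    using assms unfolding left_def by blast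
  obtain p where p: "r < p" "p < lev x"
    using r dense unfolding left_at_def by blast
  obtain q where q: "r < q" "q < lev z"
    using r dense unfolding left_at_def by blast
  show "\<exists>y. above x y \<and> above z y"
    using r by (intro exI[of _ "trunc x r"]) (auto simp: defs)
  show "\<exists>y. above x y \<and> left y z"
    using r p by (intro exI[of _ "trunc x p"] conjI) (auto simp: defs intro!: exI[of _ r])
  show "\<exists>y. above y x \<and> left y z"
    using r by (intro exI[of _ "up x"] conjI) (auto simp: defs intro!: exI[of _ r])
  show "\<exists>y. left x y \<and> above y z"
    using r by (intro exI[of _ "up z"] conjI) (auto simp: defs intro!: exI[of _ r])
  show "\<exists>y. left x y \<and> above z y"
    using r q by (intro exI[of _ "trunc z q"] conjI) (auto simp: defs intro!: exI[of _ r])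
  \<comment> \<open>x is left to the right at p > r, after the parting from z, so the new node stays
    left of z.\<close>
  have "left_at p x (branch x p 1)" "left_at r (branch x p 1) z"
    using r p by (auto simp: left_at_def)
  then show "\<exists>y. left x y \<and> left y z"
    unfolding left_def by blast
  \<comment> \<open>At r the label of z is already the larger one, so increasing it passes both
    nodes.\<close>
  show "\<exists>y. left x y \<and> left z y"
    using r by (intro exI[of _ "branch z r 1"] conjI) (auto simp: defs intro!: exI[of _ r])
  show "\<exists>y. left y x \<and> left y z"
    using r by (intro exI[of _ "branch x r (-1)"] conjI) (auto simp: defs intro!: exI[of _ r])
qed

lemma refl_factor: "\<exists>y. above x y" "\<exists>y. above y x" "\<exists>y. left x y" "\<exists>y. left y x"
proof -
  note defs = above_def left_def left_at_def
  show "\<exists>y. above x y"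
    by (intro exI[of _ "trunc x (lev x - 1)"]) (auto simp: defs)
  show "\<exists>y. above y x"
    by (intro exI[of _ "up x"]) (auto simp: defs)
  show "\<exists>y. left x y"
    by (intro exI[of _ "branch x (lev x - 1) 1"]) (auto simp: defs intro!: exI[of _ "lev x - 1"])
  show "\<exists>y. left y x"
    by (intro exI[of _ "branch x (lev x - 1) (-1)"]) (auto simp: defs intro!: exI[of _ "lev x - 1"])
qed

definition cv :: "nat \<Rightarrow> nat" where
  "cv a = (if a = 1 then 2 else if a = 2 then 1 else if a = 3 then 4 else if a = 4 then 3 else a)"

lemma cv_cv [simp]: "cv (cv a) = a"
  by (simp add: cv_def)

lemma cv_less [simp]: "cv a < 5 \<longleftrightarrow> a < 5"
  by (auto simp: cv_def)

lemma cmp_cv: "cmp y x = cv (cmp x y)"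
  using less_5_cases[OF cmp_less[of x y]] by (elim disjE) (simp_all add: cv_def cmp_iff)

lemma table_cv: "a < 5 \<Longrightarrow> b < 5 \<Longrightarrow> c \<in> table a b \<Longrightarrow> cv c \<in> table (cv b) (cv a)"
  by (drule less_5_cases, drule less_5_cases, elim disjE) (auto simp: table_def cv_def)

lemma cmp_surj: "a < 5 \<Longrightarrow> \<exists>y. cmp x y = a"
  using refl_factor[of x] by (auto dest!: less_5_cases simp: cmp_iff)

text \<open>The codes 0, 1, 3 represent all codes up to converse. For 0 the table forces
  \<open>b = cv a\<close>, and any node in position \<open>a\<close> relative to x serves.\<close>

lemma factor_weak:
  assumes "cmp x z \<in> table a b" "a < 5" "b < 5" "cmp x z \<in> {0, Suc 0, 3}"
  shows "\<exists>y. cmp x y = a \<and> cmp y z = b"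
proof -
  consider "cmp x z = 0" | "cmp x z = Suc 0" | "cmp x z = 3"
    using assms(4) by auto
  then show ?thesis
  proof cases
    case 1
    have "b = cv a"
      using less_5_cases[OF assms(2)] less_5_cases[OF assms(3)] assms(1)
      unfolding 1 by (elim disjE) (simp_all add: table_def cv_def)
    moreover obtain y where "cmp x y = a"
      using cmp_surj assms(2) by blast
    ultimately show ?thesis
      using 1 cmp_cv[of y x] by (auto simp: cmp_iff)
  next
    case 2
    then have xz: "above x z"
      by (simp add: cmp_iff)
    show ?thesis
      using less_5_cases[OF assms(2)] less_5_cases[OF assms(3)] assms(1)
      unfolding 2 by (elim disjE) (simp_all add: cmp_iff table_def xz above_factor[OF xz])
  next
    case 3
    then have xz: "left x z"
      by (simp add: cmp_iff)
    show ?thesis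
      using less_5_cases[OF assms(2)] less_5_cases[OF assms(3)] assms(1)
      unfolding 3 by (elim disjE) (simp_all add: cmp_iff table_def xz left_factor[OF xz])
  qed
qed

text \<open>Reading the composition backwards by \<open>table_cv\<close> reduces the codes 2 and 4
  to 1 and 3.\<close>

lemma factor:
  assumes "cmp x z \<in> table a b" "a < 5" "b < 5"
  shows "\<exists>y. cmp x y = a \<and> cmp y z = b"
proof (cases "cmp x z \<in> {0, Suc 0, 3}")
  case True
  then show ?thesis
    using factor_weak assms by blast
next
  case False
  then have "cmp z x \<in> {0, Suc 0, 3}"
    using less_5_cases[OF cmp_less[of x z]] cmp_cv[of z x] by (auto simp: cv_def)
  moreover have "cmp z x \<in> table (cv b) (cv a)"
    using table_cv[OF assms(2,3,1)] cmp_cv[of z x] by simp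
  ultimately obtain y where "cmp z y = cv b" "cmp y x = cv a"
    using factor_weak[of z x "cv b" "cv a"] assms by auto
  then show ?thesis
    using cmp_cv[of x y] cmp_cv[of y z] by auto
qed

section \<open>The algebra of the tree\<close>

definition atoms :: "nat set" where "atoms = {0, 1, 2, 3, 4}"

lemma atoms_iff: "a \<in> atoms \<longleftrightarrow> a < 5"
  unfolding atoms_def using less_5_cases[of a] by auto

lemma zero_atoms [simp]: "0 \<in> atoms"
  by (simp add: atoms_def)

lemma cmp_atoms: "cmp x y \<in> atoms"
  by (simp only: atoms_iff cmp_less)

lemma cv_atoms: "cv a \<in> atoms \<longleftrightarrow> a \<in> atoms"
  by (simp only: atoms_iff cv_less)

definition prd :: "nat set \<Rightarrow> nat set \<Rightarrow> nat set" where
  "prd X Y = (\<Union>a\<in>X. \<Union>b\<in>Y. table a b)"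

lemma table_atoms: "a \<in> atoms \<Longrightarrow> b \<in> atoms \<Longrightarrow> table a b \<subseteq> atoms"
  unfolding atoms_def by (elim insertE emptyE) (simp_all add: table_def)

lemma prd_atoms: "X \<subseteq> atoms \<Longrightarrow> Y \<subseteq> atoms \<Longrightarrow> prd X Y \<subseteq> atoms"
  using table_atoms unfolding prd_def by blast

text \<open>The bridge between the tree and finite computation: \<open>factor\<close> gives one
  direction and \<open>cmp_compose\<close> the other. The table thus gives full compositions, not
  mere upper bounds for them.\<close>

lemma cmp_prd:
  assumes "X \<subseteq> atoms" "Y \<subseteq> atoms"
  shows "cmp x z \<in> prd X Y \<longleftrightarrow> (\<exists>y. cmp x y \<in> X \<and> cmp y z \<in> Y)"
proof
  assume "cmp x z \<in> prd X Y"
  then obtain a b where "a \<in> X" "b \<in> Y" "cmp x z \<in> table a b"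
    unfolding prd_def by blast
  then show "\<exists>y. cmp x y \<in> X \<and> cmp y z \<in> Y"
    using factor[of x z a b] assms atoms_iff by blast
next
  assume "\<exists>y. cmp x y \<in> X \<and> cmp y z \<in> Y"
  then show "cmp x z \<in> prd X Y"
    using cmp_compose unfolding prd_def by blast
qed

lemma cmp_image_cv: "cmp x y \<in> cv ` X \<longleftrightarrow> cmp y x \<in> X"
proof
  assume "cmp x y \<in> cv ` X"
  then show "cmp y x \<in> X"
    using cmp_cv[of y x] by auto
next
  assume "cmp y x \<in> X"
  then show "cmp x y \<in> cv ` X"
    using cmp_cv[of x y] by blast
qed

text \<open>The atom structure of the tree algebra: its points are the five relation codes, not the
  nodes.\<close>

definition tree_frame :: "nat frame" where
  "tree_frame = \<lparr>points = atoms, acc = {(a, b, c). a \<in> atoms \<and> b \<in> atoms \<and> c \<in> table a b},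
     star = cv, units = {0}\<rparr>"

lemma table_diag: "a \<in> atoms \<Longrightarrow> a \<in> table a a"
  unfolding atoms_def by (elim insertE emptyE) (simp_all add: table_def)

lemma pre_CR_star_tree_frame: "pre_CR_star_frame tree_frame"
proof -
  have "is_frame tree_frame"
    using table_atoms cv_atoms unfolding is_frame_def tree_frame_def by auto
  moreover have "table 0 a = {a}" for a
    by (simp add: table_def)
  ultimately show ?thesis
    unfolding pre_CR_star_frame_def using table_diag by (auto simp: tree_frame_def)
qed

lemma complex_tree_frame:
  "carrier (complex_algebra tree_frame) = Pow atoms"
  "join (complex_algebra tree_frame) = (\<union>)"
  "cmpl (complex_algebra tree_frame) = (\<lambda>X. atoms - X)"
  "X \<subseteq> atoms \<Longrightarrow> Y \<subseteq> atoms \<Longrightarrow> relp (complex_algebra tree_frame) X Y = prd X Y"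
  "conv (complex_algebra tree_frame) = (`) cv"
  "ident (complex_algebra tree_frame) = {0}"
  unfolding complex_algebra_def tree_frame_def prd_def by (simp_all, blast)

lemma dense_tree_frame: "dense_algebra (complex_algebra tree_frame)"
proof -
  have "X \<union> prd X X = prd X X" if "X \<subseteq> atoms" for X
    using table_diag that unfolding prd_def by blast
  then show ?thesis
    unfolding dense_algebra_def by (simp add: complex_tree_frame)
qed

lemma not_commutative_tree_frame: "\<not> commutative_algebra (complex_algebra tree_frame)"
proof -
  have "3 \<in> prd {1} {2}" "3 \<notin> prd {2} {1}"
    by (simp_all add: prd_def table_def)
  then have "prd {1} {2} \<noteq> prd {2} {1}"
    by blast
  moreover have "{1} \<subseteq> atoms" "{2} \<subseteq> atoms"
    by (auto simp: atoms_def)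
  ultimately have "relp (complex_algebra tree_frame) {1} {2} \<noteq> relp (complex_algebra tree_frame) {2} {1}"
    by (simp add: complex_tree_frame)
  then show ?thesis
    using \<open>{1} \<subseteq> atoms\<close> \<open>{2} \<subseteq> atoms\<close>
    unfolding commutative_algebra_def complex_tree_frame(1) by blast
qed

text \<open>Representability prescribes the base type \<open>nat set + nat\<close>, so a node is
  coded by the graph of its labelling. Each entry repeats the level, which the labels alone do not
  determine.\<close>

definition point :: "node \<Rightarrow> nat set + nat" where
  "point x = Inl (range (\<lambda>r. to_nat (lev x, r, lab x r)))"

lemma inj_point: "point x = point y \<longleftrightarrow> x = y"
proof
  assume "point x = point y"
  then have *: "range (\<lambda>r. to_nat (lev x, r, lab x r)) = range (\<lambda>r. to_nat (lev y, r, lab y r))"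
    by (simp add: point_def)
  have "lev x = lev y \<and> lab x r = lab y r" for r
  proof -
    have "to_nat (lev x, r, lab x r) \<in> range (\<lambda>r. to_nat (lev y, r, lab y r))"
      using * by blast
    then show ?thesis
      by auto
  qed
  then show "x = y"
    by (intro node_eqI) auto
qed simp

definition rel :: "nat set \<Rightarrow> (nat set + nat) rel" where
  "rel X = {(point x, point y) | x y. cmp x y \<in> X}"

lemma mem_rel: "(point x, point y) \<in> rel X \<longleftrightarrow> cmp x y \<in> X"
  by (auto simp: rel_def inj_point)

lemma rel_elim:
  assumes "p \<in> rel X"
  obtains x y where "p = (point x, point y)" "cmp x y \<in> X"
  using assms unfolding rel_def by blast

lemma rel_atoms: "rel atoms = range point \<times> range point"
  using cmp_atoms unfolding rel_def by blast

lemma rel_union: "rel (X \<union> Y) = rel X \<union> rel Y"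
  unfolding rel_def by blast

lemma rel_compl: "rel (atoms - X) = rel atoms - rel X"
proof (intro set_eqI iffI)
  fix p assume "p \<in> rel (atoms - X)"
  then show "p \<in> rel atoms - rel X"
    by (elim rel_elim) (simp add: mem_rel)
next
  fix p assume "p \<in> rel atoms - rel X"
  then show "p \<in> rel (atoms - X)"
    by (elim DiffE rel_elim) (simp add: mem_rel)
qed

lemma rel_prd:
  assumes "X \<subseteq> atoms" "Y \<subseteq> atoms"
  shows "rel (prd X Y) = rel X O rel Y"
proof (intro set_eqI iffI)
  fix p assume "p \<in> rel (prd X Y)"
  then obtain x z where p: "p = (point x, point z)" "cmp x z \<in> prd X Y"
    by (elim rel_elim)
  then obtain y where "cmp x y \<in> X" "cmp y z \<in> Y"
    using cmp_prd[OF assms] by blast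
  then have "(point x, point y) \<in> rel X" "(point y, point z) \<in> rel Y"
    by (simp_all add: mem_rel)
  then show "p \<in> rel X O rel Y"
    unfolding p(1) by (rule relcompI)
next
  fix p assume "p \<in> rel X O rel Y"
  then obtain u v w where p: "p = (u, w)" "(u, v) \<in> rel X" "(v, w) \<in> rel Y"
    by blast
  obtain x y where xy: "u = point x" "v = point y" "cmp x y \<in> X"
    using p(2) by (elim rel_elim) simp
  obtain z where z: "w = point z" "cmp y z \<in> Y"
    using p(3) unfolding xy(2) by (elim rel_elim) (simp add: inj_point)
  show "p \<in> rel (prd X Y)"
    using p(1) xy z cmp_prd[OF assms] by (auto simp: mem_rel)
qed

lemma rel_image_cv: "rel (cv ` X) = (rel X)\<inverse>"
proof (intro set_eqI iffI)
  fix p assume "p \<in> rel (cv ` X)"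
  then show "p \<in> (rel X)\<inverse>"
    by (elim rel_elim) (simp add: mem_rel cmp_image_cv)
next
  fix p assume "p \<in> (rel X)\<inverse>"
  then show "p \<in> rel (cv ` X)"
    by (elim converseE rel_elim) (simp add: mem_rel cmp_image_cv)
qed

lemma rel_zero: "rel {0} = {(x, y). x = y \<and> (x, x) \<in> rel atoms}"
  unfolding rel_atoms by (auto simp: rel_def cmp_iff)

text \<open>Every code is realized by some pair of nodes, so \<open>rel\<close> loses no
  information.\<close>

lemma rel_subset_imp:
  assumes "rel X \<subseteq> rel Y" "X \<subseteq> atoms"
  shows "X \<subseteq> Y"
proof
  fix c assume "c \<in> X"
  then obtain x y where "cmp x y = c"
    using assms(2) cmp_surj atoms_iff by blast
  then show "c \<in> Y"
    using \<open>c \<in> X\<close> assms(1) mem_rel by blast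
qed

lemma inj_rel: "inj_on rel (Pow atoms)"
proof (rule inj_onI)
  fix X Y
  assume "X \<in> Pow atoms" "Y \<in> Pow atoms" and eq: "rel X = rel Y"
  then have "X \<subseteq> Y" "Y \<subseteq> X"
    using rel_subset_imp[of X Y] rel_subset_imp[of Y X] by simp_all
  then show "X = Y"
    by blast
qed

lemma representable_tree_frame: "representable (complex_algebra tree_frame)"
proof -
  define \<BB> where "\<BB> = \<lparr>carrier = rel ` Pow atoms, join = (\<union>), cmpl = (\<lambda>X. rel atoms - X),
    relp = (O), conv = converse, ident = rel {0}\<rparr>"
  have alg: "is_algebra \<BB>"
    unfolding is_algebra_def
  proof (intro conjI ballI)
    fix U V assume "U \<in> carrier \<BB>" "V \<in> carrier \<BB>"
    then obtain X Y where XY: "X \<subseteq> atoms" "Y \<subseteq> atoms" "U = rel X" "V = rel Y"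
      unfolding \<BB>_def by auto
    have "U \<union> V = rel (X \<union> Y)" "U O V = rel (prd X Y)"
      using XY rel_union rel_prd by auto
    then show "join \<BB> U V \<in> carrier \<BB>" "relp \<BB> U V \<in> carrier \<BB>"
      using XY(1,2) prd_atoms unfolding \<BB>_def ra.simps by blast+
  next
    fix U assume "U \<in> carrier \<BB>"
    then obtain X where X: "X \<subseteq> atoms" "U = rel X"
      unfolding \<BB>_def by auto
    have "rel atoms - U = rel (atoms - X)" "U\<inverse> = rel (cv ` X)"
      using X rel_compl rel_image_cv by auto
    moreover have "cv ` X \<subseteq> atoms"
      using X cv_atoms by blast
    ultimately show "cmpl \<BB> U \<in> carrier \<BB>" "conv \<BB> U \<in> carrier \<BB>"
      unfolding \<BB>_def ra.simps by blast+
  next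
    show "ident \<BB> \<in> carrier \<BB>"
      unfolding \<BB>_def by auto
  qed
  have "proper_relation_algebra \<BB>"
    unfolding proper_relation_algebra_def
  proof (intro conjI alg bexI[of _ "rel atoms"] ballI)
    have "Field (rel atoms) = range point"
      unfolding rel_atoms Field_def by auto
    then show "equiv (Field (rel atoms)) (rel atoms)"
      unfolding rel_atoms by (auto intro!: equivI refl_onI symI transI)
    show "X \<subseteq> rel atoms" if "X \<in> carrier \<BB>" for X
      using that unfolding \<BB>_def rel_def by auto
    show "ident \<BB> = {(x, y). x = y \<and> (x, x) \<in> rel atoms}"
      unfolding \<BB>_def using rel_zero by simp
  qed (auto simp: \<BB>_def)
  moreover have "isomorphic (complex_algebra tree_frame) \<BB>"
    unfolding isomorphic_def
  proof (intro conjI alg exI[of _ rel])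
    show "is_algebra (complex_algebra tree_frame)"
      using prd_atoms cv_atoms by (auto simp: is_algebra_def complex_tree_frame)
    show "homomorphism (complex_algebra tree_frame) \<BB> rel"
      unfolding homomorphism_def
      by (auto simp: complex_tree_frame \<BB>_def rel_union rel_prd rel_compl rel_image_cv)
    show "bij_betw rel (carrier (complex_algebra tree_frame)) (carrier \<BB>)"
      using inj_rel by (simp add: complex_tree_frame \<BB>_def bij_betw_def)
  qed
  ultimately show ?thesis
    unfolding representable_def by blast
qed

section \<open>Evaluation of predicates and refutation\<close>

primrec pval :: "(nat \<Rightarrow> nat set) \<Rightarrow> predicate \<Rightarrow> nat set" where
  "pval v 1\<^sub>p = {0}"
| "pval v (PVar i) = v i"
| "pval v (A \<^bold>+ B) = pval v A \<union> pval v B"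
| "pval v (\<^bold>-A) = atoms - pval v A"
| "pval v (A \<^bold>; B) = prd (pval v A) (pval v B)"
| "pval v (A\<^sup>\<smile>) = cv ` pval v A"

locale tree_valuation =
  fixes v :: "nat \<Rightarrow> nat set"
  assumes v_atoms: "v i \<subseteq> atoms"
begin

lemma pval_atoms: "pval v A \<subseteq> atoms"
proof (induction A)
  case (RelProd A B)
  then show ?case
    using prd_atoms by simp
next
  case (Conv A)
  then show ?case
    using cv_atoms by fastforce
qed (use v_atoms in auto)

lemma hom_pval: "homomorphism predicate_algebra (complex_algebra tree_frame) (pval v)"
  using pval_atoms complex_tree_frame(4)[OF pval_atoms pval_atoms]
  by (simp add: homomorphism_def predicate_algebra_def complex_tree_frame)

sublocale relational_model "\<lambda>A x y. cmp x y \<in> pval v A"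
proof
  fix A B x y
  show "cmp x y \<in> pval v (A \<^bold>; B) \<longleftrightarrow> (\<exists>z. cmp x z \<in> pval v A \<and> cmp z y \<in> pval v B)"
    using cmp_prd[OF pval_atoms pval_atoms] by simp
qed (use cmp_atoms in \<open>auto simp: cmp_iff cmp_image_cv\<close>)

lemma density_holds:
  assumes "X \<doteq> Y \<in> density"
  shows "(\<lambda>x y. cmp x y \<in> pval v X) = (\<lambda>x y. cmp x y \<in> pval v Y)"
proof -
  obtain A where A: "X = A \<^bold>+ A \<^bold>; A" "Y = A \<^bold>; A"
    using assms unfolding density_def by auto
  have "pval v A \<subseteq> prd (pval v A) (pval v A)"
    using table_diag pval_atoms[of A] unfolding prd_def by blast
  then have "pval v X = pval v Y"
    using A by auto
  then show ?thesis
    by simp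
qed

text \<open>The code 0 is both the diagonal of the tree and the unit of the frame, so its absence
  refutes all three claims at once.\<close>

lemma refuted:
  assumes "0 \<notin> pval v P"
  shows "P \<notin> CT_omega" "\<not> omega_provable density P" "\<not> valid tree_frame P"
proof -
  have "cmp x x \<notin> pval v P" for x
    using assms cmp_iff(1)[of x x] by simp
  then show "P \<notin> CT_omega" "\<not> omega_provable density P"
    using CT_omega_sound omega_provable_sound[OF _ density_holds] by blast+
  have "units tree_frame = {0}"
    by (simp add: tree_frame_def)
  then show "\<not> valid tree_frame P"
    using assms hom_pval unfolding valid_def by blast
qed

end

text \<open>On sets of codes this is the residual: the codes c such that every composition of a
  member of \<open>X\<close> with c stays inside \<open>Y\<close>. It is stated for sets so that
  concrete cases can be evaluated.\<close>

definition arr :: "nat set \<Rightarrow> nat set \<Rightarrow> nat set" where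
  "arr X Y = atoms - prd (cv ` X) (atoms - Y)"

definition ng :: "nat set \<Rightarrow> nat set" where
  "ng X = atoms - cv ` X"

lemma pval_arr: "pval v (A \<^bold>\<rightarrow> B) = arr (pval v A) (pval v B)"
  by (simp add: arr_def)

lemma pval_ng: "pval v (\<^bold>\<sim>A) = ng (pval v A)"
  by (simp add: ng_def)

text \<open>For \<open>X \<subseteq> atoms\<close>, \<open>0 \<in> arr X Y\<close> means
  \<open>X \<subseteq> Y\<close>, so each line is a failed inclusion. A separating code is 3 in the
  first line, where the right-hand set is empty, 2 in the second, third and fifth, and 1 in the
  fourth. The first fails because \<open>table 3 2\<close> is {3} while \<open>table 2 3\<close> is
  {2, 3}.\<close>

lemma arr_counterexamples:
  "0 \<notin> arr {3} (arr (arr {3} {1, 3}) {1, 3})"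
  "0 \<notin> arr (arr {3} (ng {1, 3})) (arr {1, 3} (ng {3}))"
  "0 \<notin> arr (arr {3} (arr {1, 3} {3})) (arr {1, 3} (arr {3} {3}))"
  "0 \<notin> arr (arr {3} {1, 3}) (arr (arr {1, 3} {3}) (arr {3} {3}))"
  "0 \<notin> arr (arr {3} (arr {1, 3} {3})) (arr (arr {3} {1, 3}) (arr {3} {3}))"
  by code_simp+

lemma theorems_refuted:
  assumes "A \<in> propositional_variables" "B \<in> propositional_variables" "C \<in> propositional_variables"
    and "distinct [A, B, C]"
  obtains v where "tree_valuation v"
    "0 \<notin> pval v (A \<^bold>\<rightarrow> ((A \<^bold>\<rightarrow> B) \<^bold>\<rightarrow> B))"
    "0 \<notin> pval v ((A \<^bold>\<rightarrow> \<^bold>\<sim>B) \<^bold>\<rightarrow> (B \<^bold>\<rightarrow> \<^bold>\<sim>A))"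
    "0 \<notin> pval v ((A \<^bold>\<rightarrow> (B \<^bold>\<rightarrow> C)) \<^bold>\<rightarrow> (B \<^bold>\<rightarrow> (A \<^bold>\<rightarrow> C)))"
    "0 \<notin> pval v ((A \<^bold>\<rightarrow> B) \<^bold>\<rightarrow> ((B \<^bold>\<rightarrow> C) \<^bold>\<rightarrow> (A \<^bold>\<rightarrow> C)))"
    "0 \<notin> pval v ((A \<^bold>\<rightarrow> (B \<^bold>\<rightarrow> C)) \<^bold>\<rightarrow> ((A \<^bold>\<rightarrow> B) \<^bold>\<rightarrow> (A \<^bold>\<rightarrow> C)))"
proof -
  \<comment> \<open>The default {3} serves \<open>A\<close>, \<open>C\<close> and all variables
    other than \<open>B\<close>.\<close>
  define v :: "nat \<Rightarrow> nat set" where "v i = (if PVar i = B then {1, 3} else {3})" for i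
  have v: "pval v A = {3}" "pval v B = {1, 3}" "pval v C = {3}"
    using assms unfolding propositional_variables_def by (auto simp: v_def)
  have "tree_valuation v"
    by unfold_locales (auto simp: v_def atoms_def)
  then show ?thesis
    by (rule that) (simp_all only: pval_arr pval_ng v arr_counterexamples not_False_eq_True)
qed

theorem theorem24:
  fixes A B C :: predicate and S :: "predicate set"
  assumes "A \<in> propositional_variables" "B \<in> propositional_variables" "C \<in> propositional_variables"
    and "distinct [A, B, C]"
    and "S = {A \<^bold>\<rightarrow> ((A \<^bold>\<rightarrow> B) \<^bold>\<rightarrow> B),
              (A \<^bold>\<rightarrow> \<^bold>\<sim>B) \<^bold>\<rightarrow> (B \<^bold>\<rightarrow> \<^bold>\<sim>A),
              (A \<^bold>\<rightarrow> (B \<^bold>\<rightarrow> C)) \<^bold>\<rightarrow> (B \<^bold>\<rightarrow> (A \<^bold>\<rightarrow> C)),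
              (A \<^bold>\<rightarrow> B) \<^bold>\<rightarrow> ((B \<^bold>\<rightarrow> C) \<^bold>\<rightarrow> (A \<^bold>\<rightarrow> C)),
              (A \<^bold>\<rightarrow> (B \<^bold>\<rightarrow> C)) \<^bold>\<rightarrow> ((A \<^bold>\<rightarrow> B) \<^bold>\<rightarrow> (A \<^bold>\<rightarrow> C))}"
  shows "(\<forall>P\<in>S. P \<in> R_logic TYPE('k) \<and> P \<in> TR \<and> P \<notin> CT_omega \<and> \<not> omega_provable density P) \<and>
    (\<exists>\<KK> :: nat frame. pre_CR_star_frame \<KK> \<and>
       \<not> commutative_algebra (complex_algebra \<KK>) \<and>
       dense_algebra (complex_algebra \<KK>) \<and>
       representable (complex_algebra \<KK>) \<and>
       (\<forall>P\<in>S. \<not> valid \<KK> P))"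
proof -
  note vars = relevance_predicates.var[OF assms(1)] relevance_predicates.var[OF assms(2)]
    relevance_predicates.var[OF assms(3)]
  obtain v where v: "tree_valuation v" and refuted: "\<forall>P\<in>S. 0 \<notin> pval v P"
    using theorems_refuted[OF assms(1-4)] unfolding assms(5) by blast
  have "\<forall>P\<in>S. P \<in> R_logic TYPE('k)"
    unfolding assms(5) using theorems_R_logic[OF vars] by blast
  moreover have "\<forall>P\<in>S. P \<in> TR"
    unfolding assms(5) using commutative_dense.theorems_TR by blast
  moreover have "\<forall>P\<in>S. P \<notin> CT_omega \<and> \<not> omega_provable density P \<and> \<not> valid tree_frame P"
    using refuted tree_valuation.refuted[OF v] by blast
  ultimately show ?thesis
    using pre_CR_star_tree_frame not_commutative_tree_frame dense_tree_frame
      representable_tree_frame by blast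
qed

end
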